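(* The space $\mathcal M_{\mathcal G,\Gamma}$ of all $\Gamma$-mixing actions of $\mathcal G$ is a complete separable metric space with respect to the metric $$\mathrm m_{\mathcal G,\Gamma}(T,S)=\sum_i 2^{-i}\sup_{g\in K_i}\mathrm d(T^g,S^g)+\sup_{g\in\Gamma}\mathrm a(T^g,S^g).$$
   Context: $(X,\Sigma,\mu)$ is a separable Lebesgue space with a non-atomic probability measure $\mu$. $\mathcal A$ is the group of invertible measure-preserving transformations of $X$, two transformations being identified if they agree outside a null set. Fix a countable family $\{A_i\}_{i\in\mathbb N}\subset\Sigma$ that generates $\Sigma$ and is dense in $\Sigma$ (for every $A\in\Sigma$ and $\varepsilon>0$ there is $i$ with $\mu(A_i\triangle A)<\varepsilon$). For $T,S\in\mathcal A$ put $\mathrm d(T,S)=\sum_{i}2^{-i}\big(\mu(TA_i\triangle SA_i)+\mu(T^{-1}A_i\triangle S^{-1}A_i)\big)$ and $\mathrm a(T,S)=\sum_{i,j}2^{-(i+j)}|\mu(TA_i\cap A_j)-\mu(SA_i\cap A_j)|$. $\mathcal G$ is a Hausdorff locally compact group with a countable neighborhood base, with identity $e$. Fix an at most countable family $\{K_i\}$ of compact subsets of $\mathcal G$ with nonempty interiors whose union contains a set generating $\mathcal G$. An action of $\mathcal G$ is a family $T=\{T^g\}_{g\in\mathcal G}\subset\mathcal A$ with $T^gT^h=T^{gh}$ for all $g,h\in\mathcal G$ and such that $g\mapsto\mu(T^gA\cap B)$ is continuous on $\mathcal G$ for all $A,B\in\Sigma$. Let $\Gamma\subset\mathcal G$ be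 an unbounded subset (not contained in any compact set). An action $T$ is $\Gamma$-mixing if for all $A,B\in\Sigma$ and $\varepsilon>0$ there is a compact $C\subset\mathcal G$ with $|\mu(T^gA\cap B)-\mu(A)\mu(B)|<\varepsilon$ for all $g\in\Gamma\setminus C$. $\mathcal M_{\mathcal G,\Gamma}$ is the set of all $\Gamma$-mixing actions of $\mathcal G$. *)

theory Defs
  imports "HOL-Probability.Probability"
begin

definition nonatomic_lebesgue_space :: "'a measure \<Rightarrow> bool" where
  "nonatomic_lebesgue_space M \<longleftrightarrow> prob_space M \<and>
     (\<exists>N N' f. N \<in> null_sets M \<and> N' \<in> null_sets (lebesgue_on {0..1::real}) \<and>
        bij_betw f (space M - N) ({0..1} - N') \<and>
        (\<forall>A. A \<subseteq> space M \<longrightarrow> (A \<in> sets M \<longleftrightarrow> f ` (A - N) \<in> sets (lebesgue_on {0..1}))) \<and>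
        (\<forall>A \<in> sets M. emeasure M A = emeasure (lebesgue_on {0..1}) (f ` (A - N))))"

definition generating_dense_family :: "'a measure \<Rightarrow> (nat \<Rightarrow> 'a set) \<Rightarrow> bool" where
  "generating_dense_family M A \<longleftrightarrow> (\<forall>i. A i \<in> sets M) \<and>
     (\<forall>B \<in> sets M. \<exists>C \<in> sigma_sets (space M) (range A). B - C \<union> (C - B) \<in> null_sets M) \<and>
     (\<forall>B \<in> sets M. \<forall>\<epsilon>>0. \<exists>i. measure M (B - A i \<union> (A i - B)) < \<epsilon>)"

definition measure_preserving_map :: "'a measure \<Rightarrow> ('a \<Rightarrow> 'a) \<Rightarrow> bool" where
  "measure_preserving_map M T \<longleftrightarrow> T \<in> measurable M M \<and>
     (\<forall>B \<in> sets M. emeasure M (T -` B \<inter> space M) = emeasure M B)"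

text \<open>Membership in the group \<open>\<A>\<close> (elements are identified modulo null sets).\<close>
definition invertible_mpt :: "'a measure \<Rightarrow> ('a \<Rightarrow> 'a) \<Rightarrow> bool" where
  "invertible_mpt M T \<longleftrightarrow> measure_preserving_map M T \<and>
     (\<exists>S. measure_preserving_map M S \<and> (AE x in M. S (T x) = x) \<and> (AE x in M. T (S x) = x))"

definition mpt_inv :: "'a measure \<Rightarrow> ('a \<Rightarrow> 'a) \<Rightarrow> 'a \<Rightarrow> 'a" where
  "mpt_inv M T = (SOME S. measure_preserving_map M S \<and> (AE x in M. S (T x) = x) \<and> (AE x in M. T (S x) = x))"

text \<open>The image \<open>T A\<close> of a set (well-defined mod 0): the preimage under the inverse.\<close>
definition mpt_img :: "'a measure \<Rightarrow> ('a \<Rightarrow> 'a) \<Rightarrow> 'a set \<Rightarrow> 'a set" where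
  "mpt_img M T B = mpt_inv M T -` B \<inter> space M"

definition mpt_preimg :: "'a measure \<Rightarrow> ('a \<Rightarrow> 'a) \<Rightarrow> 'a set \<Rightarrow> 'a set" where
  "mpt_preimg M T B = T -` B \<inter> space M"

definition symdiff :: "'a set \<Rightarrow> 'a set \<Rightarrow> 'a set" where
  "symdiff B C = (B - C) \<union> (C - B)"

definition dist_d :: "'a measure \<Rightarrow> (nat \<Rightarrow> 'a set) \<Rightarrow> ('a \<Rightarrow> 'a) \<Rightarrow> ('a \<Rightarrow> 'a) \<Rightarrow> real" where
  "dist_d M A T S = (\<Sum>i. (1/2) ^ i *
      (measure M (symdiff (mpt_img M T (A i)) (mpt_img M S (A i))) +
       measure M (symdiff (mpt_preimg M T (A i)) (mpt_preimg M S (A i)))))"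

definition dist_a :: "'a measure \<Rightarrow> (nat \<Rightarrow> 'a set) \<Rightarrow> ('a \<Rightarrow> 'a) \<Rightarrow> ('a \<Rightarrow> 'a) \<Rightarrow> real" where
  "dist_a M A T S = (\<Sum>i. \<Sum>j. (1/2) ^ (i + j) *
      \<bar>measure M (mpt_img M T (A i) \<inter> A j) - measure M (mpt_img M S (A i) \<inter> A j)\<bar>)"

text \<open>A Hausdorff locally compact topological group with a countable neighbourhood base
  (group operation written additively, not necessarily commutative).\<close>
definition lc_topological_group :: "'g::{group_add,t2_space,first_countable_topology} itself \<Rightarrow> bool" where
  "lc_topological_group _ \<longleftrightarrow>
     continuous_on UNIV (\<lambda>p::'g \<times> 'g. fst p + snd p) \<and>
     continuous_on UNIV (uminus :: 'g \<Rightarrow> 'g) \<and>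
     locally_compact_space (euclidean :: 'g topology)"

definition is_subgroup :: "'g::group_add set \<Rightarrow> bool" where
  "is_subgroup H \<longleftrightarrow> 0 \<in> H \<and> (\<forall>x\<in>H. \<forall>y\<in>H. x + y \<in> H) \<and> (\<forall>x\<in>H. - x \<in> H)"

definition generated_subgroup :: "'g::group_add set \<Rightarrow> 'g set" where
  "generated_subgroup S = \<Inter>{H. S \<subseteq> H \<and> is_subgroup H}"

definition unbounded_set :: "'g::topological_space set \<Rightarrow> bool" where
  "unbounded_set \<Gamma> \<longleftrightarrow> \<not> (\<exists>C. compact C \<and> \<Gamma> \<subseteq> C)"

definition is_action :: "'a measure \<Rightarrow> ('g::{group_add,topological_space} \<Rightarrow> 'a \<Rightarrow> 'a) \<Rightarrow> bool" where
  "is_action M T \<longleftrightarrow> (\<forall>g. invertible_mpt M (T g)) \<and>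
     (\<forall>g h. AE x in M. T g (T h x) = T (g + h) x) \<and>
     (\<forall>B \<in> sets M. \<forall>C \<in> sets M. continuous_on UNIV (\<lambda>g. measure M (mpt_img M (T g) B \<inter> C)))"

definition gamma_mixing :: "'a measure \<Rightarrow> 'g::{group_add,topological_space} set \<Rightarrow> ('g \<Rightarrow> 'a \<Rightarrow> 'a) \<Rightarrow> bool" where
  "gamma_mixing M \<Gamma> T \<longleftrightarrow> (\<forall>B \<in> sets M. \<forall>C \<in> sets M. \<forall>\<epsilon>>0. \<exists>K. compact K \<and>
     (\<forall>g \<in> \<Gamma> - K. \<bar>measure M (mpt_img M (T g) B \<inter> C) - measure M B * measure M C\<bar> < \<epsilon>))"

definition mixing_actions :: "'a measure \<Rightarrow> 'g::{group_add,topological_space} set \<Rightarrow> ('g \<Rightarrow> 'a \<Rightarrow> 'a) set" where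
  "mixing_actions M \<Gamma> = {T. is_action M T \<and> gamma_mixing M \<Gamma> T}"

definition action_equiv :: "'a measure \<Rightarrow> ('g \<Rightarrow> 'a \<Rightarrow> 'a) \<Rightarrow> ('g \<Rightarrow> 'a \<Rightarrow> 'a) \<Rightarrow> bool" where
  "action_equiv M T S \<longleftrightarrow> (\<forall>g. AE x in M. T g x = S g x)"

text \<open>The metric \<open>m_{G,\<Gamma>}\<close>; the family \<open>K_i\<close> is indexed by an at most countable set I of naturals.\<close>
definition metric_m :: "'a measure \<Rightarrow> (nat \<Rightarrow> 'a set) \<Rightarrow> nat set \<Rightarrow> (nat \<Rightarrow> 'g set) \<Rightarrow> 'g set \<Rightarrow>
    ('g \<Rightarrow> 'a \<Rightarrow> 'a) \<Rightarrow> ('g \<Rightarrow> 'a \<Rightarrow> 'a) \<Rightarrow> real" where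
  "metric_m M A I K \<Gamma> T S =
     (\<Sum>i. if i \<in> I then (1/2) ^ i * (SUP g\<in>K i. dist_d M A (T g) (S g)) else 0) +
     (SUP g\<in>\<Gamma>. dist_a M A (T g) (S g))"

end

theory Submission
  imports Defs
begin

text \<open>The metric \<open>m\<close> arises from the pseudometric \<open>\<mu>(B \<triangle> C)\<close> on measurable sets and from differences of
  correlations by pulling back, adding, and taking dyadically weighted sums and suprema, and so
  inherits symmetry and the triangle inequality. The set of \<open>g\<close> with \<open>T\<^sup>g = S\<^sup>g\<close> almost everywhere is
  a subgroup; if \<open>m(T, S) = 0\<close>, it contains all \<open>K\<^sub>i\<close>, hence everything.

  For completeness, the \<open>g\<close> for which \<open>T\<^sub>n\<^sup>g\<close> and \<open>T\<^sub>n\<^bsup>-g\<^esup>\<close> converge again form a subgroup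
  containing all \<open>K\<^sub>i\<close>. A Cauchy sequence of transformations has a limit because, after identifying
  the space with the unit interval, a subsequence converges almost everywhere, and the limit is a
  random variable with the distribution of the coordinate. Uniform convergence on some \<open>K\<^sub>i\<close> gives
  continuity of the limit action on an open set, hence everywhere, and uniform convergence of the
  correlations on \<open>\<Gamma>\<close> preserves mixing.

  For separability, the group is \<open>\<sigma>\<close>-compact and first countable, hence second countable. Mixing
  reduces the comparison of two actions along \<open>\<Gamma>\<close> to a compact set, on which an action is described
  up to a small error by finitely many basic open sets and finitely many of the sets \<open>A\<^sub>i\<close>.\<close>

subsection \<open>Dyadically weighted sums\<close>

definition dyadic_sum :: "(nat \<Rightarrow> real) \<Rightarrow> real" where
  "dyadic_sum b = (\<Sum>i. (1/2) ^ i * b i)"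

lemma summable_dyadic:
  assumes "\<And>i. b i \<in> {0..c}"
  shows "summable (\<lambda>i. (1/2) ^ i * b i :: real)"
proof (rule summable_comparison_test')
  show "summable (\<lambda>i. (1/2) ^ i * c)" by (intro summable_mult2 summable_geometric) simp
  show "norm ((1/2) ^ i * b i) \<le> (1/2) ^ i * c" for i
    using assms[of i] by simp
qed

lemma dyadic_sum_const: "dyadic_sum (\<lambda>_. c) = 2 * c"
  using suminf_mult2[OF summable_geometric, of "1/2::real" c] suminf_geometric[of "1/2::real"]
  by (simp add: dyadic_sum_def)

lemma dyadic_sum_add:
  assumes "\<And>i. b i \<in> {0..c}" "\<And>i. b' i \<in> {0..c'}"
  shows "dyadic_sum (\<lambda>i. b i + b' i) = dyadic_sum b + dyadic_sum b'"
  unfolding dyadic_sum_def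
  using suminf_add[OF summable_dyadic[of b, OF assms(1)] summable_dyadic[of b', OF assms(2)]]
  by (simp add: distrib_left)

lemma dyadic_sum_mono:
  assumes "\<And>i. b i \<in> {0..c}" "\<And>i. b' i \<in> {0..c'}" "\<And>i. b i \<le> b' i"
  shows "dyadic_sum b \<le> dyadic_sum b'"
  unfolding dyadic_sum_def
  using suminf_le[OF _ summable_dyadic[of b, OF assms(1)] summable_dyadic[of b', OF assms(2)]]
    assms(3) by (simp add: mult_left_mono)

lemma dyadic_sum_range:
  assumes "\<And>i. b i \<in> {0..c}"
  shows "dyadic_sum b \<in> {0..2 * c}"
proof -
  have c_nonneg: "0 \<le> c" using assms[of 0] by simp
  have "dyadic_sum (\<lambda>_. 0) \<le> dyadic_sum b" "dyadic_sum b \<le> dyadic_sum (\<lambda>_. c)"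
    using assms c_nonneg by (auto intro!: dyadic_sum_mono[where c = c and c' = c])
  then show ?thesis by (simp add: dyadic_sum_const)
qed

lemma term_le_dyadic_sum:
  assumes "\<And>i. b i \<in> {0..c}"
  shows "b i \<le> 2 ^ i * dyadic_sum b"
proof -
  have "(\<Sum>j\<in>{i}. (1/2) ^ j * b j) \<le> dyadic_sum b"
    unfolding dyadic_sum_def using assms by (intro sum_le_suminf summable_dyadic) auto
  then have "2 ^ i * ((1/2) ^ i * b i) \<le> 2 ^ i * dyadic_sum b" by (intro mult_left_mono) auto
  then show ?thesis by (simp add: power_one_over)
qed

lemma dyadic_sum_le_if_initial_le:
  assumes range: "\<And>i. b i \<in> {0..c}" and initial: "\<And>i. i < N \<Longrightarrow> b i \<le> \<delta>" and "0 \<le> \<delta>"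
  shows "dyadic_sum b \<le> 2 * \<delta> + 2 * c * (1/2) ^ N"
proof -
  have c_nonneg: "0 \<le> c" using range[of 0] by simp
  define tail where "tail i = (if i < N then 0 else c)" for i
  have "b i \<le> \<delta> + tail i" for i using range[of i] initial[of i] \<open>0 \<le> \<delta>\<close> by (simp add: tail_def)
  then have "dyadic_sum b \<le> dyadic_sum (\<lambda>i. \<delta> + tail i)"
    using range \<open>0 \<le> \<delta>\<close> c_nonneg
    by (intro dyadic_sum_mono[where c' = "\<delta> + c"]) (auto simp: tail_def)
  also have "\<dots> = 2 * \<delta> + dyadic_sum tail"
    using \<open>0 \<le> \<delta>\<close> c_nonneg
    by (subst dyadic_sum_add[where c = \<delta> and c' = c]) (auto simp: tail_def dyadic_sum_const)
  also have "dyadic_sum tail = (\<Sum>i. (1/2) ^ (i + N) * tail (i + N)) + (\<Sum>i<N. (1/2) ^ i * tail i)"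
    unfolding dyadic_sum_def
    using c_nonneg
    by (intro suminf_split_initial_segment summable_dyadic[of _ c]) (simp add: tail_def)
  also have "\<dots> = dyadic_sum (\<lambda>_. (1/2) ^ N * c)"
    by (simp add: tail_def dyadic_sum_def power_add mult.assoc)
  finally show ?thesis by (simp add: dyadic_sum_const mult.commute)
qed

lemma dyadic_sum_tendsto_0:
  assumes range: "\<And>n i. b n i \<in> {0..c}" and lim: "\<And>i. (\<lambda>n. b n i) \<longlonglongrightarrow> 0"
  shows "(\<lambda>n. dyadic_sum (b n)) \<longlonglongrightarrow> 0"
proof -
  have "(\<lambda>n. \<Sum>i. (1/2) ^ i * b n i) \<longlonglongrightarrow> (\<Sum>i. 0)"
  proof (rule tannerys_theorem[THEN conjunct2, THEN conjunct2])
    show "(\<lambda>n. (1/2) ^ i * b n i) \<longlonglongrightarrow> 0" for i by (intro tendsto_mult_right_zero lim)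
    show "\<forall>\<^sub>F (i, n) in sequentially \<times>\<^sub>F sequentially. norm ((1/2) ^ i * b n i) \<le> (1/2) ^ i * c"
      using range by (intro always_eventually) simp
    show "summable (\<lambda>i. (1/2) ^ i * c)" by (intro summable_mult2 summable_geometric) simp
  qed simp
  then show ?thesis by (simp add: dyadic_sum_def)
qed

subsection \<open>Bounded pseudometrics\<close>

locale bounded_pseudometric =
  fixes S :: "'a set" and c :: real and \<rho> :: "'a \<Rightarrow> 'a \<Rightarrow> real"
  assumes range: "x \<in> S \<Longrightarrow> y \<in> S \<Longrightarrow> \<rho> x y \<in> {0..c}"
    and self: "x \<in> S \<Longrightarrow> \<rho> x x = 0"
    and commute: "x \<in> S \<Longrightarrow> y \<in> S \<Longrightarrow> \<rho> x y = \<rho> y x"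
    and triangle: "x \<in> S \<Longrightarrow> y \<in> S \<Longrightarrow> z \<in> S \<Longrightarrow> \<rho> x z \<le> \<rho> x y + \<rho> y z"

lemma bounded_pseudometric_zero: "0 \<le> c \<Longrightarrow> bounded_pseudometric S c (\<lambda>x y. 0)"
  by unfold_locales auto

lemma bounded_pseudometric_pullback:
  assumes "bounded_pseudometric S c \<rho>" and "\<And>x. x \<in> S' \<Longrightarrow> f x \<in> S"
  shows "bounded_pseudometric S' c (\<lambda>x y. \<rho> (f x) (f y))"
proof -
  interpret bounded_pseudometric S c \<rho> by fact
  show ?thesis
    using assms(2) range self commute triangle by (intro bounded_pseudometric.intro) simp_all
qed

lemma bounded_pseudometric_add:
  assumes "bounded_pseudometric S c \<rho>" and "bounded_pseudometric S c' \<rho>'"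
  shows "bounded_pseudometric S (c + c') (\<lambda>x y. \<rho> x y + \<rho>' x y)"
proof -
  interpret \<rho>: bounded_pseudometric S c \<rho> + \<rho>': bounded_pseudometric S c' \<rho>' by fact+
  show ?thesis
  proof
    fix x y z assume S: "x \<in> S" "y \<in> S" "z \<in> S"
    show "\<rho> x z + \<rho>' x z \<le> \<rho> x y + \<rho>' x y + (\<rho> y z + \<rho>' y z)"
      using \<rho>.triangle[OF S] \<rho>'.triangle[OF S] by linarith
    show "\<rho> x y + \<rho>' x y \<in> {0..c + c'}"
      using \<rho>.range[OF S(1,2)] \<rho>'.range[OF S(1,2)] by simp
    show "\<rho> x y + \<rho>' x y = \<rho> y x + \<rho>' y x"
      using \<rho>.commute[OF S(1,2)] \<rho>'.commute[OF S(1,2)] by simp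
  qed (simp add: \<rho>.self \<rho>'.self)
qed

lemma bounded_pseudometric_dyadic_sum:
  assumes "\<And>i. bounded_pseudometric S c (\<rho> i)"
  shows "bounded_pseudometric S (2 * c) (\<lambda>x y. dyadic_sum (\<lambda>i. \<rho> i x y))"
proof -
  interpret \<rho>: bounded_pseudometric S c "\<rho> i" for i by fact
  show ?thesis
  proof
    fix x y z assume S: "x \<in> S" "y \<in> S" "z \<in> S"
    have "dyadic_sum (\<lambda>i. \<rho> i x z) \<le> dyadic_sum (\<lambda>i. \<rho> i x y + \<rho> i y z)"
    proof (rule dyadic_sum_mono)
      show "\<rho> i x z \<in> {0..c}" for i by (rule \<rho>.range[OF S(1,3)])
      show "\<rho> i x y + \<rho> i y z \<in> {0..c + c}" for i
        using \<rho>.range[OF S(1,2), of i] \<rho>.range[OF S(2,3), of i] by simp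
      show "\<rho> i x z \<le> \<rho> i x y + \<rho> i y z" for i by (rule \<rho>.triangle[OF S])
    qed
    also have "\<dots> = dyadic_sum (\<lambda>i. \<rho> i x y) + dyadic_sum (\<lambda>i. \<rho> i y z)"
      by (rule dyadic_sum_add[OF \<rho>.range[OF S(1,2)] \<rho>.range[OF S(2,3)]])
    finally show "dyadic_sum (\<lambda>i. \<rho> i x z) \<le> dyadic_sum (\<lambda>i. \<rho> i x y) + dyadic_sum (\<lambda>i. \<rho> i y z)" .
    show "dyadic_sum (\<lambda>i. \<rho> i x y) \<in> {0..2 * c}" by (rule dyadic_sum_range[OF \<rho>.range[OF S(1,2)]])
    show "dyadic_sum (\<lambda>i. \<rho> i x y) = dyadic_sum (\<lambda>i. \<rho> i y x)"
      by (simp add: \<rho>.commute[OF S(1,2)])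
  qed (simp add: \<rho>.self dyadic_sum_const)
qed

lemma bounded_pseudometric_bdd_above:
  assumes "\<And>g. g \<in> Z \<Longrightarrow> bounded_pseudometric S c (\<rho> g)" and "x \<in> S" "y \<in> S"
  shows "bdd_above ((\<lambda>g. \<rho> g x y) ` Z)"
  using bounded_pseudometric.range[OF assms(1) assms(2,3)] by (intro bdd_aboveI[of _ c]) auto

lemma bounded_pseudometric_SUP:
  assumes \<rho>: "\<And>g. g \<in> Z \<Longrightarrow> bounded_pseudometric S c (\<rho> g)" and Z: "Z \<noteq> {}"
  shows "bounded_pseudometric S c (\<lambda>x y. SUP g\<in>Z. \<rho> g x y)"
proof
  fix x y z assume S: "x \<in> S" "y \<in> S" "z \<in> S"
  have upper: "\<rho> g u v \<le> (SUP g\<in>Z. \<rho> g u v)" if "g \<in> Z" "u \<in> S" "v \<in> S" for g u v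
    using that(2,3) by (intro cSUP_upper that(1) bounded_pseudometric_bdd_above[OF \<rho>])
  show "(SUP g\<in>Z. \<rho> g x z) \<le> (SUP g\<in>Z. \<rho> g x y) + (SUP g\<in>Z. \<rho> g y z)"
  proof (rule cSUP_least[OF Z])
    fix g assume "g \<in> Z"
    then show "\<rho> g x z \<le> (SUP g\<in>Z. \<rho> g x y) + (SUP g\<in>Z. \<rho> g y z)"
      using bounded_pseudometric.triangle[OF \<rho> S] upper[of g x y] upper[of g y z] S by fastforce
  qed
  obtain g where "g \<in> Z" using Z by blast
  then have "0 \<le> (SUP g\<in>Z. \<rho> g x y)"
    using bounded_pseudometric.range[OF \<rho> S(1,2)] upper[of g x y] S by fastforce
  moreover have "(SUP g\<in>Z. \<rho> g x y) \<le> c"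
    using bounded_pseudometric.range[OF \<rho> S(1,2)] by (intro cSUP_least[OF Z]) auto
  ultimately show "(SUP g\<in>Z. \<rho> g x y) \<in> {0..c}" by simp
  show "(SUP g\<in>Z. \<rho> g x y) = (SUP g\<in>Z. \<rho> g y x)"
    using bounded_pseudometric.commute[OF \<rho> S(1,2)] by simp
next
  show "(SUP g\<in>Z. \<rho> g x x) = 0" if "x \<in> S" for x
    using bounded_pseudometric.self[OF \<rho> that] Z by simp
qed

definition cauchy_wrt :: "('a \<Rightarrow> 'a \<Rightarrow> real) \<Rightarrow> (nat \<Rightarrow> 'a) \<Rightarrow> bool" where
  "cauchy_wrt \<rho> X \<longleftrightarrow> (\<forall>e>0. \<exists>N. \<forall>p\<ge>N. \<forall>n\<ge>N. \<rho> (X p) (X n) < e)"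

lemma cauchy_wrtD:
  assumes "cauchy_wrt \<rho> X" "0 < e"
  obtains N where "\<And>p n. N \<le> p \<Longrightarrow> N \<le> n \<Longrightarrow> \<rho> (X p) (X n) < e"
  using assms unfolding cauchy_wrt_def by meson

lemma cauchy_wrt_dominated:
  assumes "cauchy_wrt \<rho> X" "0 < C" and dominated: "\<And>p n. \<rho>' (Y p) (Y n) \<le> C * \<rho> (X p) (X n)"
  shows "cauchy_wrt \<rho>' Y"
  unfolding cauchy_wrt_def
proof (intro allI impI)
  fix e :: real assume "0 < e"
  then obtain N where "\<And>p n. N \<le> p \<Longrightarrow> N \<le> n \<Longrightarrow> \<rho> (X p) (X n) < e / C"
    using cauchy_wrtD[OF assms(1), of "e / C"] \<open>0 < C\<close> by auto
  then have "C * \<rho> (X p) (X n) < e" if "N \<le> p" "N \<le> n" for p n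
    using that \<open>0 < C\<close> by (simp add: pos_less_divide_eq mult.commute)
  then show "\<exists>N. \<forall>p\<ge>N. \<forall>n\<ge>N. \<rho>' (Y p) (Y n) < e"
    using dominated le_less_trans by blast
qed

lemma SUP_tendsto_0_if_cauchy_wrt_SUP:
  assumes \<rho>: "\<And>g. g \<in> Z \<Longrightarrow> bounded_pseudometric S c (\<rho> g)" and Z: "Z \<noteq> {}"
    and X: "\<And>n. X n \<in> S" and V: "V \<in> S"
    and cauchy: "cauchy_wrt (\<lambda>x y. SUP g\<in>Z. \<rho> g x y) X"
    and lim: "\<And>g. g \<in> Z \<Longrightarrow> (\<lambda>n. \<rho> g (X n) V) \<longlonglongrightarrow> 0"
  shows "(\<lambda>n. SUP g\<in>Z. \<rho> g (X n) V) \<longlonglongrightarrow> 0"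
proof (rule LIMSEQ_I)
  fix e :: real assume "0 < e"
  obtain N where close: "\<And>p n. N \<le> p \<Longrightarrow> N \<le> n \<Longrightarrow> (SUP g\<in>Z. \<rho> g (X p) (X n)) < e / 2"
    using cauchy_wrtD[OF cauchy, of "e / 2"] \<open>0 < e\<close> by auto
  have "\<rho> g (X n) V \<le> e / 2" if "N \<le> n" "g \<in> Z" for n g
  proof -
    have "(\<lambda>p. e / 2 + \<rho> g (X p) V) \<longlonglongrightarrow> e / 2 + 0" by (intro tendsto_intros lim \<open>g \<in> Z\<close>)
    moreover have "\<rho> g (X n) V \<le> e / 2 + \<rho> g (X p) V" if "N \<le> p" for p
    proof -
      have "\<rho> g (X n) (X p) \<le> (SUP g\<in>Z. \<rho> g (X n) (X p))"
        by (intro cSUP_upper \<open>g \<in> Z\<close> bounded_pseudometric_bdd_above[OF \<rho> X X])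
      also have "\<dots> < e / 2" by (rule close[OF \<open>N \<le> n\<close> that])
      finally show ?thesis
        using bounded_pseudometric.triangle[OF \<rho>[OF \<open>g \<in> Z\<close>] X[of n] X[of p] V] by linarith
    qed
    ultimately have "\<rho> g (X n) V \<le> e / 2 + 0" by (intro LIMSEQ_le_const) auto
    then show ?thesis by simp
  qed
  then have "(SUP g\<in>Z. \<rho> g (X n) V) \<le> e / 2" if "N \<le> n" for n
    using that by (intro cSUP_least[OF Z])
  moreover have "0 \<le> (SUP g\<in>Z. \<rho> g (X n) V)" for n
    using bounded_pseudometric.range[OF bounded_pseudometric_SUP[OF \<rho> Z] X[of n] V] by simp
  ultimately have "norm ((SUP g\<in>Z. \<rho> g (X n) V) - 0) < e" if "N \<le> n" for n
    using that \<open>0 < e\<close> by fastforce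
  then show "\<exists>N. \<forall>n\<ge>N. norm ((SUP g\<in>Z. \<rho> g (X n) V) - 0) < e" by blast
qed

lemma separable_if_countable_small_covers:
  fixes \<rho> :: "'a \<Rightarrow> 'a \<Rightarrow> real"
  assumes "\<And>e. 0 < e \<Longrightarrow>
    \<exists>\<U>. countable \<U> \<and> X \<subseteq> \<Union>\<U> \<and> (\<forall>U\<in>\<U>. \<forall>x\<in>X \<inter> U. \<forall>y\<in>X \<inter> U. \<rho> x y < e)"
  shows "\<exists>D\<subseteq>X. countable D \<and> (\<forall>x\<in>X. \<forall>e>0. \<exists>y\<in>D. \<rho> x y < e)"
proof -
  define small_cover where "small_cover e \<U> \<longleftrightarrow> countable \<U> \<and> X \<subseteq> \<Union>\<U> \<and>
    (\<forall>U\<in>\<U>. \<forall>x\<in>X \<inter> U. \<forall>y\<in>X \<inter> U. \<rho> x y < e)" for e \<U>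
  have "\<forall>n. \<exists>\<U>. small_cover (inverse (real (Suc n))) \<U>"
    unfolding small_cover_def by (intro allI assms) simp
  from choice[OF this] obtain \<U> where "\<And>n. small_cover (inverse (real (Suc n))) (\<U> n)"
    by blast
  then have \<U>: "\<And>n. countable (\<U> n)" "\<And>n. X \<subseteq> \<Union>(\<U> n)"
    and small: "\<And>n U x y. U \<in> \<U> n \<Longrightarrow> x \<in> X \<inter> U \<Longrightarrow> y \<in> X \<inter> U \<Longrightarrow> \<rho> x y < inverse (real (Suc n))"
    unfolding small_cover_def by blast+
  define D where "D = (\<Union>n. (\<lambda>U. SOME y. y \<in> X \<inter> U) ` {U \<in> \<U> n. X \<inter> U \<noteq> {}})"
  have pick: "(SOME y. y \<in> X \<inter> U) \<in> X \<inter> U" if "X \<inter> U \<noteq> {}" for U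
    using that by (simp only: some_in_eq not_False_eq_True)
  have "\<exists>y\<in>D. \<rho> x y < e" if "x \<in> X" "0 < e" for x e
  proof -
    obtain n where n: "inverse (real (Suc n)) < e" using reals_Archimedean[OF \<open>0 < e\<close>] by blast
    obtain U where U: "U \<in> \<U> n" "x \<in> U" using \<U>(2) \<open>x \<in> X\<close> by blast
    have nonempty: "X \<inter> U \<noteq> {}" using U \<open>x \<in> X\<close> by blast
    have "\<rho> x (SOME y. y \<in> X \<inter> U) < e"
      using small[OF U(1) _ pick[OF nonempty], of x] U(2) \<open>x \<in> X\<close> n by simp
    moreover have "(SOME y. y \<in> X \<inter> U) \<in> D" unfolding D_def using U(1) nonempty by blast
    ultimately show ?thesis by blast
  qed
  moreover have "countable D"
    unfolding D_def using \<U>(1) by (intro countable_UN countable_image countable_Collect) auto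
  moreover have "D \<subseteq> X" unfolding D_def using pick by blast
  ultimately show ?thesis by blast
qed

subsection \<open>The measure algebra\<close>

definition sdist :: "'a measure \<Rightarrow> 'a set \<Rightarrow> 'a set \<Rightarrow> real" where
  "sdist M B C = measure M (symdiff B C)"

lemma symdiff_sets [measurable, simp, intro]:
  "B \<in> sets M \<Longrightarrow> C \<in> sets M \<Longrightarrow> symdiff B C \<in> sets M"
  by (auto simp: symdiff_def)

lemma sdist_commute: "sdist M B C = sdist M C B"
  by (simp add: sdist_def symdiff_def Un_commute)

lemma sdist_nonneg [simp]: "0 \<le> sdist M B C"
  by (simp add: sdist_def)

context prob_space
begin

lemma sdist_triangle:
  assumes "B \<in> sets M" "C \<in> sets M" "D \<in> sets M"
  shows "sdist M B D \<le> sdist M B C + sdist M C D"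
proof -
  have "measure M (symdiff B D) \<le> measure M (symdiff B C \<union> symdiff C D)"
    using assms by (intro finite_measure_mono) (auto simp: symdiff_def)
  also have "\<dots> \<le> measure M (symdiff B C) + measure M (symdiff C D)"
    using assms by (intro measure_Un_le) auto
  finally show ?thesis by (simp add: sdist_def)
qed

lemma bounded_pseudometric_sdist: "bounded_pseudometric (sets M) 1 (sdist M)"
proof
  show "sdist M B B = 0" for B by (simp add: sdist_def symdiff_def)
  show "sdist M B C \<in> {0..1}" for B C by (simp add: sdist_def)
qed (auto intro: sdist_triangle simp: sdist_commute)

lemma sdist_eq:
  assumes "B \<in> sets M" "C \<in> sets M"
  shows "sdist M B C = measure M B + measure M C - 2 * measure M (B \<inter> C)"
proof -
  have "measure M (symdiff B C) = measure M (B - C) + measure M (C - B)"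
    unfolding symdiff_def using assms by (intro finite_measure_Union) auto
  moreover have "measure M (B - C) = measure M B - measure M (B \<inter> C)"
    using assms by (rule finite_measure_Diff')
  moreover have "measure M (C - B) = measure M C - measure M (B \<inter> C)"
    using assms by (simp add: finite_measure_Diff' Int_commute)
  ultimately show ?thesis by (simp add: sdist_def)
qed

lemma abs_measure_diff_le_sdist:
  assumes "B \<in> sets M" "C \<in> sets M"
  shows "\<bar>measure M B - measure M C\<bar> \<le> sdist M B C"
proof -
  have "measure M (B \<inter> C) \<le> measure M B" "measure M (B \<inter> C) \<le> measure M C"
    using assms by (auto intro!: finite_measure_mono)
  then show ?thesis using sdist_eq[OF assms] by linarith
qed

lemma sdist_Int_le:
  assumes "B \<in> sets M" "B' \<in> sets M" "C \<in> sets M" "C' \<in> sets M"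
  shows "sdist M (B \<inter> C) (B' \<inter> C') \<le> sdist M B B' + sdist M C C'"
proof -
  have "measure M (symdiff (B \<inter> C) (B' \<inter> C')) \<le> measure M (symdiff B B' \<union> symdiff C C')"
    using assms by (intro finite_measure_mono) (auto simp: symdiff_def)
  also have "\<dots> \<le> measure M (symdiff B B') + measure M (symdiff C C')"
    using assms by (intro measure_Un_le) auto
  finally show ?thesis by (simp add: sdist_def)
qed

lemma abs_measure_Int_diff_le_sdist:
  assumes "B \<in> sets M" "B' \<in> sets M" "C \<in> sets M" "C' \<in> sets M"
  shows "\<bar>measure M (B \<inter> C) - measure M (B' \<inter> C')\<bar> \<le> sdist M B B' + sdist M C C'"
  using abs_measure_diff_le_sdist[of "B \<inter> C" "B' \<inter> C'"] sdist_Int_le[OF assms] assms by auto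

lemma sdist_eq_0_iff:
  assumes "B \<in> sets M" "C \<in> sets M"
  shows "sdist M B C = 0 \<longleftrightarrow> (AE x in M. x \<in> B \<longleftrightarrow> x \<in> C)"
proof -
  have "sdist M B C = 0 \<longleftrightarrow> symdiff B C \<in> null_sets M"
    unfolding sdist_def using assms by (auto simp: null_sets_def emeasure_eq_measure)
  also have "\<dots> \<longleftrightarrow> (AE x in M. x \<notin> symdiff B C)"
    using assms by (intro AE_iff_null_sets) auto
  also have "\<dots> \<longleftrightarrow> (AE x in M. x \<in> B \<longleftrightarrow> x \<in> C)"
    by (intro AE_cong) (auto simp: symdiff_def)
  finally show ?thesis .
qed

lemma sdist_cong_AE:
  assumes "B \<in> sets M" "C \<in> sets M" "B' \<in> sets M" "C' \<in> sets M"
    and "AE x in M. x \<in> B \<longleftrightarrow> x \<in> B'" "AE x in M. x \<in> C \<longleftrightarrow> x \<in> C'"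
  shows "sdist M B C = sdist M B' C'"
  unfolding sdist_def
proof (rule measure_eq_AE)
  show "AE x in M. x \<in> symdiff B C \<longleftrightarrow> x \<in> symdiff B' C'"
    using assms(5,6) by eventually_elim (simp add: symdiff_def)
qed (use assms in auto)

lemma AE_eventually_const_if_summable_sdist:
  assumes [measurable]: "\<And>k. E k \<in> sets M" and summable: "summable (\<lambda>k. sdist M (E k) (E (Suc k)))"
  shows "AE x in M. (\<forall>\<^sub>F k in sequentially. x \<in> E k) \<or> (\<forall>\<^sub>F k in sequentially. x \<notin> E k)"
proof -
  have "AE x in M. \<forall>\<^sub>F k in sequentially. x \<in> space M - symdiff (E k) (E (Suc k))"
    using summable by (intro borel_cantelli_AE1) (auto simp: sdist_def less_top[symmetric])
  then show ?thesis
  proof eventually_elim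
    case (elim x)
    then obtain n where step: "\<And>k. n \<le> k \<Longrightarrow> x \<in> E (Suc k) \<longleftrightarrow> x \<in> E k"
      by (auto simp: eventually_sequentially symdiff_def)
    have "x \<in> E k \<longleftrightarrow> x \<in> E n" if "n \<le> k" for k
      using that by (induction k rule: dec_induct) (simp_all add: step)
    then show ?case unfolding eventually_sequentially by blast
  qed
qed

end

subsection \<open>Measure-preserving maps\<close>

lemma measure_preserving_map_iff_distr:
  "measure_preserving_map M U \<longleftrightarrow> U \<in> M \<rightarrow>\<^sub>M M \<and> distr M M U = M"
proof
  assume U: "measure_preserving_map M U"
  then have "distr M M U = M"
    by (intro measure_eqI) (auto simp: measure_preserving_map_def emeasure_distr)
  with U show "U \<in> M \<rightarrow>\<^sub>M M \<and> distr M M U = M" by (simp add: measure_preserving_map_def)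
next
  assume U: "U \<in> M \<rightarrow>\<^sub>M M \<and> distr M M U = M"
  then have "emeasure M (U -` B \<inter> space M) = emeasure M B" if "B \<in> sets M" for B
    using emeasure_distr[of U M M B] that by simp
  with U show "measure_preserving_map M U" by (simp add: measure_preserving_map_def)
qed

lemma measure_preserving_map_measurable:
  "measure_preserving_map M U \<Longrightarrow> U \<in> M \<rightarrow>\<^sub>M M"
  by (simp add: measure_preserving_map_def)

lemma measure_preserving_map_AE:
  assumes U: "measure_preserving_map M U" and "AE x in M. P x"
  shows "AE x in M. P (U x)"
proof -
  have "distr M M U = M" using U by (simp add: measure_preserving_map_iff_distr)
  with assms(2) have "AE x in distr M M U. P x" by (simp only:)
  then show ?thesis by (rule AE_distrD[OF measure_preserving_map_measurable[OF U]])
qed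

lemma measure_preserving_map_id: "measure_preserving_map M (\<lambda>x. x)"
  by (simp add: measure_preserving_map_iff_distr)

lemma measure_preserving_map_comp:
  assumes "measure_preserving_map M U" "measure_preserving_map M V"
  shows "measure_preserving_map M (\<lambda>x. U (V x))"
proof -
  have [measurable]: "U \<in> M \<rightarrow>\<^sub>M M" "V \<in> M \<rightarrow>\<^sub>M M"
    using assms by (simp_all add: measure_preserving_map_measurable)
  have "distr M M (\<lambda>x. U (V x)) = distr (distr M M V) M U"
    by (simp add: distr_distr comp_def)
  then show ?thesis using assms by (simp add: measure_preserving_map_iff_distr)
qed

lemma mpt_preimg_sets [simp, intro]:
  "measure_preserving_map M U \<Longrightarrow> B \<in> sets M \<Longrightarrow> mpt_preimg M U B \<in> sets M"
  unfolding mpt_preimg_def by (rule measurable_sets[OF measure_preserving_map_measurable])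

lemma mpt_preimg_comp:
  assumes "measure_preserving_map M V"
  shows "mpt_preimg M (\<lambda>x. U (V x)) B = mpt_preimg M V (mpt_preimg M U B)"
  using measurable_space[OF measure_preserving_map_measurable[OF assms]]
  by (auto simp: mpt_preimg_def)

lemma measure_mpt_preimg:
  "measure_preserving_map M U \<Longrightarrow> B \<in> sets M \<Longrightarrow> measure M (mpt_preimg M U B) = measure M B"
  by (simp add: measure_preserving_map_def measure_def mpt_preimg_def)

lemma sdist_mpt_preimg:
  assumes "measure_preserving_map M U" "B \<in> sets M" "C \<in> sets M"
  shows "sdist M (mpt_preimg M U B) (mpt_preimg M U C) = sdist M B C"
proof -
  have "symdiff (mpt_preimg M U B) (mpt_preimg M U C) = mpt_preimg M U (symdiff B C)"
    by (auto simp: symdiff_def mpt_preimg_def)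
  then show ?thesis using assms by (simp add: sdist_def measure_mpt_preimg)
qed

abbreviation preimg_dist :: "'a measure \<Rightarrow> 'a set \<Rightarrow> ('a \<Rightarrow> 'a) \<Rightarrow> ('a \<Rightarrow> 'a) \<Rightarrow> real" where
  "preimg_dist M B U V \<equiv> sdist M (mpt_preimg M U B) (mpt_preimg M V B)"

abbreviation img_dist :: "'a measure \<Rightarrow> 'a set \<Rightarrow> ('a \<Rightarrow> 'a) \<Rightarrow> ('a \<Rightarrow> 'a) \<Rightarrow> real" where
  "img_dist M B U V \<equiv> sdist M (mpt_img M U B) (mpt_img M V B)"

lemma
  assumes "invertible_mpt M U"
  shows measure_preserving_map_mpt_inv: "measure_preserving_map M (mpt_inv M U)"
    and AE_mpt_inv_left: "AE x in M. mpt_inv M U (U x) = x"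
    and AE_mpt_inv_right: "AE x in M. U (mpt_inv M U x) = x"
proof -
  have "\<exists>V. measure_preserving_map M V \<and> (AE x in M. V (U x) = x) \<and> (AE x in M. U (V x) = x)"
    using assms by (simp add: invertible_mpt_def)
  from someI_ex[OF this] show "measure_preserving_map M (mpt_inv M U)"
    "AE x in M. mpt_inv M U (U x) = x" "AE x in M. U (mpt_inv M U x) = x"
    by (simp_all add: mpt_inv_def)
qed

lemma measure_preserving_map_if_invertible_mpt: "invertible_mpt M U \<Longrightarrow> measure_preserving_map M U"
  by (simp add: invertible_mpt_def)

lemma AE_mpt_inv_eq:
  assumes U: "invertible_mpt M U" and "AE x in M. V (U x) = x"
  shows "AE x in M. mpt_inv M U x = V x"
  using measure_preserving_map_AE[OF measure_preserving_map_mpt_inv[OF U] assms(2)]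
    AE_mpt_inv_right[OF U]
  by eventually_elim simp

lemma mpt_img_eq_mpt_preimg: "mpt_img M U = mpt_preimg M (mpt_inv M U)"
  by (auto simp: mpt_img_def mpt_preimg_def)

lemma mpt_img_sets [simp, intro]:
  "invertible_mpt M U \<Longrightarrow> B \<in> sets M \<Longrightarrow> mpt_img M U B \<in> sets M"
  by (simp add: mpt_img_eq_mpt_preimg measure_preserving_map_mpt_inv)

lemma measure_mpt_img:
  "invertible_mpt M U \<Longrightarrow> B \<in> sets M \<Longrightarrow> measure M (mpt_img M U B) = measure M B"
  by (simp add: mpt_img_eq_mpt_preimg measure_preserving_map_mpt_inv measure_mpt_preimg)

lemma sdist_mpt_img:
  "invertible_mpt M U \<Longrightarrow> B \<in> sets M \<Longrightarrow> C \<in> sets M \<Longrightarrow>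
    sdist M (mpt_img M U B) (mpt_img M U C) = sdist M B C"
  by (simp add: mpt_img_eq_mpt_preimg measure_preserving_map_mpt_inv sdist_mpt_preimg)

context prob_space
begin

lemma sdist_mpt_preimg_cong_AE:
  assumes "measure_preserving_map M U" "measure_preserving_map M U'" "AE x in M. U x = U' x"
    and "measure_preserving_map M V" "measure_preserving_map M V'" "AE x in M. V x = V' x"
    and "B \<in> sets M" "C \<in> sets M"
  shows "sdist M (mpt_preimg M U B) (mpt_preimg M V C)
    = sdist M (mpt_preimg M U' B) (mpt_preimg M V' C)"
proof (rule sdist_cong_AE)
  show "AE x in M. x \<in> mpt_preimg M U B \<longleftrightarrow> x \<in> mpt_preimg M U' B"
    using assms(3) by eventually_elim (simp add: mpt_preimg_def)
  show "AE x in M. x \<in> mpt_preimg M V C \<longleftrightarrow> x \<in> mpt_preimg M V' C"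
    using assms(6) by eventually_elim (simp add: mpt_preimg_def)
qed (use assms in auto)

lemma preimg_dist_approx:
  assumes U: "measure_preserving_map M U" and V: "measure_preserving_map M V"
    and B: "B \<in> sets M" and C: "C \<in> sets M"
  shows "preimg_dist M B U V \<le> 2 * sdist M B C + preimg_dist M C U V"
proof -
  have "preimg_dist M B U V
      \<le> sdist M (mpt_preimg M U B) (mpt_preimg M U C)
        + sdist M (mpt_preimg M U C) (mpt_preimg M V B)"
    using assms by (intro sdist_triangle) auto
  also have "sdist M (mpt_preimg M U C) (mpt_preimg M V B)
      \<le> preimg_dist M C U V + sdist M (mpt_preimg M V C) (mpt_preimg M V B)"
    using assms by (intro sdist_triangle) auto
  finally show ?thesis
    using sdist_mpt_preimg[OF U B C] sdist_mpt_preimg[OF V C B] sdist_commute[of M B C] by linarith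
qed

end

definition mpt_tendsto :: "'a measure \<Rightarrow> (nat \<Rightarrow> 'a \<Rightarrow> 'a) \<Rightarrow> ('a \<Rightarrow> 'a) \<Rightarrow> bool" where
  "mpt_tendsto M U V \<longleftrightarrow> (\<forall>n. measure_preserving_map M (U n)) \<and> measure_preserving_map M V \<and>
     (\<forall>B\<in>sets M. (\<lambda>n. preimg_dist M B (U n) V) \<longlonglongrightarrow> 0)"

lemma
  assumes "mpt_tendsto M U V"
  shows mpt_tendsto_preserving: "measure_preserving_map M (U n)"
    and mpt_tendsto_limit_preserving: "measure_preserving_map M V"
    and mpt_tendsto_preimg_dist: "B \<in> sets M \<Longrightarrow> (\<lambda>n. preimg_dist M B (U n) V) \<longlonglongrightarrow> 0"
  using assms by (simp_all add: mpt_tendsto_def)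

context prob_space
begin

lemma mpt_tendsto_cong_AE:
  assumes "mpt_tendsto M U V"
    and "\<And>n. measure_preserving_map M (U' n)" "\<And>n. AE x in M. U n x = U' n x"
    and "measure_preserving_map M V'" "AE x in M. V x = V' x"
  shows "mpt_tendsto M U' V'"
proof -
  have "preimg_dist M B (U n) V = preimg_dist M B (U' n) V'"
    if "B \<in> sets M" for n B
    using assms that by (intro sdist_mpt_preimg_cong_AE) (auto simp: mpt_tendsto_def)
  then show ?thesis using assms by (simp add: mpt_tendsto_def)
qed

lemma mpt_tendsto_const:
  "measure_preserving_map M U \<Longrightarrow> mpt_tendsto M (\<lambda>n. U) U"
  by (simp add: mpt_tendsto_def bounded_pseudometric.self[OF bounded_pseudometric_sdist])

lemma mpt_tendsto_comp:
  assumes U: "mpt_tendsto M U U'" and V: "mpt_tendsto M V V'"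
  shows "mpt_tendsto M (\<lambda>n x. U n (V n x)) (\<lambda>x. U' (V' x))"
  unfolding mpt_tendsto_def
proof (intro conjI allI ballI)
  note U_mp = mpt_tendsto_preserving[OF U] and U'_mp = mpt_tendsto_limit_preserving[OF U]
  note V_mp = mpt_tendsto_preserving[OF V] and V'_mp = mpt_tendsto_limit_preserving[OF V]
  show "measure_preserving_map M (\<lambda>x. U n (V n x))" for n
    by (rule measure_preserving_map_comp[OF U_mp V_mp])
  show "measure_preserving_map M (\<lambda>x. U' (V' x))"
    by (rule measure_preserving_map_comp[OF U'_mp V'_mp])
  fix B assume B: "B \<in> sets M"
  define C where "C = mpt_preimg M U' B"
  have C: "C \<in> sets M" using B U'_mp by (simp add: C_def)
  let ?bound = "\<lambda>n. sdist M (mpt_preimg M (U n) B) C + preimg_dist M C (V n) V'"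
  have bound_lim: "?bound \<longlonglongrightarrow> 0"
    using mpt_tendsto_preimg_dist[OF U B] mpt_tendsto_preimg_dist[OF V C] unfolding C_def
    by (rule tendsto_add_zero)
  have bound: "preimg_dist M B (\<lambda>x. U n (V n x)) (\<lambda>x. U' (V' x)) \<le> ?bound n" for n
  proof -
    have "sdist M (mpt_preimg M (V n) (mpt_preimg M (U n) B)) (mpt_preimg M V' C)
        \<le> sdist M (mpt_preimg M (V n) (mpt_preimg M (U n) B)) (mpt_preimg M (V n) C)
          + preimg_dist M C (V n) V'"
      using B C U_mp V_mp V'_mp by (intro sdist_triangle) auto
    also have "sdist M (mpt_preimg M (V n) (mpt_preimg M (U n) B)) (mpt_preimg M (V n) C)
        = sdist M (mpt_preimg M (U n) B) C"
      using B C U_mp V_mp by (intro sdist_mpt_preimg) auto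
    finally show ?thesis
      unfolding C_def mpt_preimg_comp[OF V_mp, where U = "U n"]
        mpt_preimg_comp[OF V'_mp, where U = U'] .
  qed
  show "(\<lambda>n. preimg_dist M B (\<lambda>x. U n (V n x)) (\<lambda>x. U' (V' x))) \<longlonglongrightarrow> 0"
    by (rule Lim_null_comparison[OF _ bound_lim]) (simp add: bound)
qed

end

subsection \<open>Lebesgue spaces\<close>

text \<open>A transformation of a Lebesgue space is determined by its coordinate \<open>\<phi> \<circ> T\<close>, a real random
  variable with the same distribution as \<open>\<phi>\<close>; conversely \<open>\<psi>\<close> turns each such random variable into a
  transformation. The completion is needed because \<open>M\<close> has more sets than preimages of Borel sets.\<close>

locale lebesgue_space = prob_space M + complete_measure M for M :: "'a measure" +
  fixes \<phi> :: "'a \<Rightarrow> real" and \<psi> :: "real \<Rightarrow> 'a"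
  assumes coordinate_measurable [measurable]: "\<phi> \<in> borel_measurable M"
    and coordinate_range: "\<phi> x \<in> {0..1}"
    and point_measurable: "\<psi> \<in> completion (distr M borel \<phi>) \<rightarrow>\<^sub>M M"
    and AE_point_coordinate: "AE x in M. \<psi> (\<phi> x) = x"

locale lebesgue_chart = prob_space M for M :: "'a measure" +
  fixes N :: "'a set" and N' :: "real set" and f :: "'a \<Rightarrow> real"
  assumes null_N: "N \<in> null_sets M"
    and null_N': "N' \<in> null_sets (lebesgue_on {0..1})"
    and bij_f: "bij_betw f (space M - N) ({0..1} - N')"
    and sets_iff: "B \<subseteq> space M \<Longrightarrow> B \<in> sets M \<longleftrightarrow> f ` (B - N) \<in> sets (lebesgue_on {0..1})"
    and emeasure_eq: "B \<in> sets M \<Longrightarrow> emeasure M B = emeasure (lebesgue_on {0..1}) (f ` (B - N))"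
begin

definition coordinate :: "'a \<Rightarrow> real" where
  "coordinate x = (if x \<in> space M - N then f x else 0)"

definition point :: "real \<Rightarrow> 'a" where
  "point t = (if t \<in> {0..1} - N' then inv_into (space M - N) f t else SOME x. x \<in> space M)"

lemma f_image: "f ` (space M - N) = {0..1} - N'" and inj_on_f: "inj_on f (space M - N)"
  using bij_f by (auto simp: bij_betw_def)

lemma sets_lebesgue_on_iff:
  "Z \<in> sets (lebesgue_on {0..1::real}) \<longleftrightarrow> Z \<subseteq> {0..1} \<and> Z \<in> sets lebesgue"
  by (subst sets_restrict_space_iff) auto

lemma null_sets_lebesgue_on_iff:
  "Z \<in> null_sets (lebesgue_on {0..1::real}) \<longleftrightarrow> Z \<subseteq> {0..1} \<and> Z \<in> null_sets lebesgue"
  by (subst null_sets_restrict_space) auto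

lemma complete_measure_M: "complete_measure M"
proof
  fix B C assume "C \<subseteq> B" and B: "B \<in> null_sets M"
  have "B \<subseteq> space M" using B by (auto dest: sets.sets_into_space)
  have "f ` (B - N) \<in> null_sets (lebesgue_on {0..1})"
    using B sets_iff[OF \<open>B \<subseteq> space M\<close>] emeasure_eq[of B] by (auto simp: null_sets_def)
  moreover have "f ` (C - N) \<subseteq> f ` (B - N)" using \<open>C \<subseteq> B\<close> by blast
  ultimately have "f ` (C - N) \<in> null_sets (lebesgue_on {0..1})"
    unfolding null_sets_lebesgue_on_iff using null_sets_completion_subset by blast
  then show "C \<in> sets M"
    using \<open>C \<subseteq> B\<close> \<open>B \<subseteq> space M\<close> sets_iff[of C] by (auto intro: null_setsD2)
qed

lemma coordinate_range: "coordinate x \<in> {0..1}"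
  using f_image by (auto simp: coordinate_def)

lemma
  assumes Z: "Z \<in> sets borel"
  shows sets_coordinate_vimage: "coordinate -` Z \<inter> space M \<in> sets M"
    and emeasure_coordinate_vimage:
      "emeasure M (coordinate -` Z \<inter> space M) = emeasure lebesgue (Z \<inter> {0..1})"
proof -
  have image: "f ` (coordinate -` Z \<inter> space M - N) = Z \<inter> {0..1} - N'"
  proof -
    have "f ` (coordinate -` Z \<inter> space M - N) = f ` (space M - N) \<inter> Z"
      by (auto simp: coordinate_def)
    also have "\<dots> = Z \<inter> {0..1} - N'" unfolding f_image by auto
    finally show ?thesis .
  qed
  have Z': "Z \<inter> {0..1} \<in> sets (lebesgue_on {0..1})"
    using Z by (simp add: sets_lebesgue_on_iff)
  then have "f ` (coordinate -` Z \<inter> space M - N) \<in> sets (lebesgue_on {0..1})"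
    unfolding image using null_N' by auto
  then show sets: "coordinate -` Z \<inter> space M \<in> sets M" by (simp add: sets_iff)
  have "emeasure M (coordinate -` Z \<inter> space M) = emeasure (lebesgue_on {0..1}) (Z \<inter> {0..1})"
    unfolding emeasure_eq[OF sets] image by (rule emeasure_Diff_null_set[OF null_N' Z'])
  also have "\<dots> = emeasure lebesgue (Z \<inter> {0..1})" by (intro emeasure_restrict_space) auto
  finally show "emeasure M (coordinate -` Z \<inter> space M) = emeasure lebesgue (Z \<inter> {0..1})" .
qed

lemma coordinate_measurable: "coordinate \<in> borel_measurable M"
  using sets_coordinate_vimage by (intro measurableI) auto

lemma sets_lebesgue_subset_completion:
  "sets lebesgue \<subseteq> sets (completion (distr M borel coordinate))"
proof -
  let ?P = "distr M borel coordinate"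
  have "(\<lambda>t. t) \<in> completion ?P \<rightarrow>\<^sub>M lebesgue"
  proof (rule completion.measurable_completion2)
    show id: "(\<lambda>t. t) \<in> completion ?P \<rightarrow>\<^sub>M lborel" by (rule measurable_completion) simp
    show "null_sets lborel \<subseteq> null_sets (distr (completion ?P) lborel (\<lambda>t. t))"
    proof
      fix Z :: "real set" assume Z: "Z \<in> null_sets lborel"
      then have "Z \<inter> {0..1} \<in> null_sets lebesgue"
        by (intro null_sets_completion_subset[OF Int_lower1 null_sets_completionI])
      then have "emeasure lebesgue (Z \<inter> {0..1}) = 0" by (rule null_setsD1)
      then have "emeasure ?P Z = 0"
        using Z coordinate_measurable
        by (simp add: emeasure_distr emeasure_coordinate_vimage null_sets_def)
      then have "Z \<in> null_sets (completion ?P)"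
        using Z by (intro null_sets_completionI) (simp add: null_sets_def)
      then show "Z \<in> null_sets (distr (completion ?P) lborel (\<lambda>t. t))"
        using Z id by (simp add: null_sets_def emeasure_distr)
    qed
  qed
  then show ?thesis using measurable_sets[of "\<lambda>t. t" "completion ?P" lebesgue] by auto
qed

lemma point_mem_iff:
  assumes t: "t \<in> {0..1} - N'" and B: "B \<subseteq> space M"
  shows "point t \<in> B \<longleftrightarrow> t \<in> f ` (B - N)"
proof -
  have "t \<in> f ` (space M - N)" using t f_image by simp
  then have "point t \<in> space M - N" "f (point t) = t"
    using t inv_into_into[of t f "space M - N"] f_inv_into_f[of t f "space M - N"]
    by (auto simp: point_def)
  then show ?thesis using inj_on_image_mem_iff[OF inj_on_f, of "point t" "B - N"] B by auto
qed

lemma point_vimage_sets: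
  assumes B: "B \<in> sets M"
  shows "point -` B \<in> sets lebesgue"
proof -
  define x0 where "x0 = (SOME x. x \<in> space M)"
  have "B \<subseteq> space M" using B by (rule sets.sets_into_space)
  have outside: "point t = x0" if "t \<notin> {0..1} - N'" for t
    unfolding point_def x0_def using that by (rule if_not_P)
  have "f ` (B - N) \<subseteq> {0..1} - N'" using f_image \<open>B \<subseteq> space M\<close> by blast
  then have "t \<in> point -` B \<longleftrightarrow> t \<in> f ` (B - N) \<union> (if x0 \<in> B then - ({0..1} - N') else {})" for t
    using point_mem_iff[OF _ \<open>B \<subseteq> space M\<close>] outside by (cases "t \<in> {0..1} - N'") auto
  then have "point -` B = f ` (B - N) \<union> (if x0 \<in> B then - ({0..1} - N') else {})" by blast
  moreover have "- ({0..1} - N') \<in> sets lebesgue"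
    using null_N' unfolding Compl_eq_Diff_UNIV
    by (intro sets.Diff) (auto simp: null_sets_lebesgue_on_iff)
  moreover have "f ` (B - N) \<in> sets lebesgue"
    using B sets_iff[OF \<open>B \<subseteq> space M\<close>] by (simp add: sets_lebesgue_on_iff)
  ultimately show ?thesis by (simp add: sets.Un)
qed

lemma point_measurable: "point \<in> completion (distr M borel coordinate) \<rightarrow>\<^sub>M M"
proof (rule measurableI)
  show "point t \<in> space M" for t
    using not_empty inv_into_into[of t f "space M - N"] f_image
    by (auto simp: point_def some_in_eq)
  show "point -` B \<inter> space (completion (distr M borel coordinate))
      \<in> sets (completion (distr M borel coordinate))" if "B \<in> sets M" for B
    using point_vimage_sets[OF that] sets_lebesgue_subset_completion by auto
qed

lemma lebesgue_space_coordinate_point: "lebesgue_space M coordinate point"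
proof (intro lebesgue_space.intro lebesgue_space_axioms.intro)
  show "AE x in M. point (coordinate x) = x"
    using AE_not_in[OF null_N] AE_space
  proof eventually_elim
    case (elim x)
    then have "x \<in> space M - N" by simp
    moreover from this have "f x \<in> {0..1} - N'" using f_image by blast
    ultimately show ?case using inj_on_f by (simp add: coordinate_def point_def)
  qed
qed (auto intro: prob_space_axioms complete_measure_M coordinate_measurable point_measurable
    simp: coordinate_range[simplified])

end

lemma lebesgue_space_if_nonatomic_lebesgue_space:
  assumes "nonatomic_lebesgue_space M"
  obtains \<phi> \<psi> where "lebesgue_space M \<phi> \<psi>"
proof -
  obtain N N' f where "lebesgue_chart M N N' f"
    using assms unfolding nonatomic_lebesgue_space_def lebesgue_chart_def lebesgue_chart_axioms_def
    by blast
  then show ?thesis using that lebesgue_chart.lebesgue_space_coordinate_point by blast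
qed

lemma (in complete_measure)
  assumes F: "F \<in> M \<rightarrow>\<^sub>M N" and distr: "distr M N F = P"
  shows measurable_completion_distr: "F \<in> M \<rightarrow>\<^sub>M completion P"
    and distr_completion_distr: "distr M (completion P) F = completion P"
proof -
  have sets: "sets P = sets N" unfolding distr[symmetric] by simp
  then have F': "F \<in> M \<rightarrow>\<^sub>M P" using F by (simp cong: measurable_cong_sets)
  have P: "distr M P F = P" using distr sets by (simp cong: distr_cong)
  show "F \<in> M \<rightarrow>\<^sub>M completion P" by (rule measurable_completion2[OF F']) (simp add: P)
  show "distr M (completion P) F = completion P" using completion_distr_eq[OF F'] by (simp add: P)
qed

context lebesgue_space
begin

lemma distr_point: "distr (completion (distr M borel \<phi>)) M \<psi> = M"
proof -
  let ?P = "completion (distr M borel \<phi>)"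
  note \<phi> = measurable_completion_distr[OF coordinate_measurable refl]
  have "distr ?P M \<psi> = distr (distr M ?P \<phi>) M \<psi>"
    by (simp add: distr_completion_distr[OF coordinate_measurable refl])
  also have "\<dots> = distr M M (\<psi> \<circ> \<phi>)" by (rule distr_distr[OF point_measurable \<phi>])
  also have "\<dots> = distr M M (\<lambda>x. x)"
    using AE_point_coordinate measurable_comp[OF \<phi> point_measurable] by (intro distr_cong_AE) auto
  finally show ?thesis by simp
qed

lemma AE_coordinate_point: "AE t in completion (distr M borel \<phi>). \<phi> (\<psi> t) = t"
proof -
  let ?P = "completion (distr M borel \<phi>)"
  note \<phi> = measurable_completion_distr[OF coordinate_measurable refl]
  have [measurable]: "(\<lambda>t. t) \<in> borel_measurable ?P" by (rule measurable_completion) simp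
  have [measurable]: "(\<lambda>t. \<phi> (\<psi> t)) \<in> borel_measurable ?P"
    using measurable_comp[OF point_measurable coordinate_measurable] by (simp add: comp_def)
  have "{t \<in> space ?P. \<phi> (\<psi> t) = t} \<in> sets ?P" by measurable
  moreover have "AE x in M. \<phi> (\<psi> (\<phi> x)) = \<phi> x" using AE_point_coordinate by eventually_elim simp
  ultimately have "AE t in distr M ?P \<phi>. \<phi> (\<psi> t) = t" by (simp add: AE_distr_iff[OF \<phi>])
  then show ?thesis by (simp only: distr_completion_distr[OF coordinate_measurable refl])
qed

lemma measure_preserving_map_with_coordinate:
  assumes F: "F \<in> borel_measurable M" and distr: "distr M borel F = distr M borel \<phi>"
  obtains T where "measure_preserving_map M T" "AE x in M. \<phi> (T x) = F x"
proof
  let ?P = "completion (distr M borel \<phi>)"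
  note F_measurable = measurable_completion_distr[OF F distr]
  have "distr M M (\<psi> \<circ> F) = distr (distr M ?P F) M \<psi>"
    by (rule distr_distr[OF point_measurable F_measurable, symmetric])
  also have "\<dots> = M" by (simp only: distr_completion_distr[OF F distr] distr_point)
  finally show "measure_preserving_map M (\<psi> \<circ> F)"
    using measurable_comp[OF F_measurable point_measurable]
    by (simp add: measure_preserving_map_iff_distr)
  have "AE t in distr M ?P F. \<phi> (\<psi> t) = t"
    using AE_coordinate_point by (simp only: distr_completion_distr[OF F distr])
  then show "AE x in M. \<phi> ((\<psi> \<circ> F) x) = F x"
    using AE_distrD[OF F_measurable] by simp
qed

lemma coordinate_open_dense:
  assumes B: "B \<in> sets M" and e_pos: "0 < e"
  obtains W where "open W" "sdist M B (\<phi> -` W \<inter> space M) < e"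
proof -
  let ?P = "distr M borel \<phi>"
  interpret P: prob_space ?P by (rule prob_space_distr) simp
  have "\<psi> -` B \<in> sets (completion ?P)" using measurable_sets[OF point_measurable B] by simp
  then obtain C where
    C: "C \<in> sets ?P" "\<psi> -` B \<subseteq> C" "emeasure (completion ?P) (\<psi> -` B) = emeasure ?P C"
    by (rule completion_upper)
  have "emeasure ?P C = (INF U \<in> {U. C \<subseteq> U \<and> open U}. emeasure ?P U)"
    using C(1) by (intro outer_regular) auto
  moreover have "emeasure ?P C < emeasure ?P C + ennreal e"
    using e_pos
    by (simp add: P.emeasure_eq_measure ennreal_less_iff ennreal_plus[symmetric] del: ennreal_plus)
  ultimately obtain W where W: "C \<subseteq> W" "open W" "emeasure ?P W < emeasure ?P C + ennreal e"
    by (auto simp: INF_less_iff)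
  let ?W = "\<phi> -` W \<inter> space M"
  have sets: "?W \<in> sets M" using W(2) by measurable
  have "emeasure ?P C = emeasure (distr (completion ?P) M \<psi>) B"
    using B point_measurable by (simp add: emeasure_distr flip: C(3))
  then have "measure M ?W < measure M B + e"
    using W(2,3) e_pos by (simp add: distr_point emeasure_distr emeasure_eq_measure ennreal_less_iff
        ennreal_plus[symmetric] del: ennreal_plus)
  moreover have "measure M (B \<inter> ?W) = measure M B"
  proof (rule measure_eq_AE)
    show "AE x in M. x \<in> B \<inter> ?W \<longleftrightarrow> x \<in> B"
      using AE_point_coordinate AE_space by eventually_elim (use C(2) W(1) in auto)
  qed (use B sets in auto)
  ultimately have "sdist M B ?W < e" using sdist_eq[OF B sets] by simp
  with W(2) show ?thesis by (rule that)
qed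

lemma AE_eq_if_preimg_dist_eq_0:
  assumes U: "measure_preserving_map M U" and V: "measure_preserving_map M V"
    and eq: "\<And>B. B \<in> sets M \<Longrightarrow> preimg_dist M B U V = 0"
  shows "AE x in M. U x = V x"
proof -
  define B where "B q = {x \<in> space M. \<phi> x < real_of_rat q}" for q
  have B: "B q \<in> sets M" for q unfolding B_def by measurable
  have "AE x in M. \<forall>q. x \<in> mpt_preimg M U (B q) \<longleftrightarrow> x \<in> mpt_preimg M V (B q)"
    unfolding AE_all_countable using eq B U V by (auto simp flip: sdist_eq_0_iff)
  moreover note measure_preserving_map_AE[OF U AE_point_coordinate]
    measure_preserving_map_AE[OF V AE_point_coordinate] AE_space
  ultimately show ?thesis
  proof eventually_elim
    case (elim x)
    have "U x \<in> space M" "V x \<in> space M"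
      using measure_preserving_map_measurable[OF U] measure_preserving_map_measurable[OF V] elim(4)
      by (auto dest: measurable_space)
    then have "\<phi> (U x) < real_of_rat q \<longleftrightarrow> \<phi> (V x) < real_of_rat q" for q
      using elim(1,4) by (simp add: mpt_preimg_def B_def)
    then have "\<phi> (U x) = \<phi> (V x)" by (metis linorder_less_linear of_rat_dense order_less_asym)
    then show ?case using elim(2,3) by metis
  qed
qed

lemma mpt_tendsto_unique:
  assumes V: "mpt_tendsto M U V" and V': "mpt_tendsto M U V'"
  shows "AE x in M. V x = V' x"
proof (rule AE_eq_if_preimg_dist_eq_0)
  show V_mp: "measure_preserving_map M V" by (rule mpt_tendsto_limit_preserving[OF V])
  show V'_mp: "measure_preserving_map M V'" by (rule mpt_tendsto_limit_preserving[OF V'])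
  fix B assume B: "B \<in> sets M"
  have "preimg_dist M B V V' \<le> preimg_dist M B (U n) V + preimg_dist M B (U n) V'" for n
    using sdist_triangle[of "mpt_preimg M V B" "mpt_preimg M (U n) B" "mpt_preimg M V' B"]
      mpt_tendsto_preserving[OF V] V_mp V'_mp B
    by (simp add: sdist_commute)
  then have "preimg_dist M B V V' \<le> 0"
    using tendsto_add_zero[OF mpt_tendsto_preimg_dist[OF V B] mpt_tendsto_preimg_dist[OF V' B]]
    by (intro LIMSEQ_le_const) auto
  then show "preimg_dist M B V V' = 0" by (simp add: antisym)
qed

end

subsection \<open>Completeness of the group of transformations\<close>

lemma convergent_if_rat_cuts_decided:
  fixes u :: "nat \<Rightarrow> real"
  assumes range: "\<And>k. u k \<in> {a..b}"
    and decided: "\<And>q.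
      (\<forall>\<^sub>F k in sequentially. u k < real_of_rat q) \<or> (\<forall>\<^sub>F k in sequentially. \<not> u k < real_of_rat q)"
  shows "convergent u"
proof -
  define L where "L = {real_of_rat q | q. \<forall>\<^sub>F k in sequentially. \<not> u k < real_of_rat q}"
  have "u \<longlonglongrightarrow> Sup L"
  proof (rule order_tendstoI)
    fix l assume "l < Sup L"
    moreover have "L \<noteq> {}"
    proof -
      obtain q where "real_of_rat q < a" using of_rat_dense[of "a - 1" a] by auto
      then have "\<not> u k < real_of_rat q" for k using range[of k] by simp
      then show ?thesis by (auto simp: L_def intro!: always_eventually)
    qed
    ultimately obtain q where "l < real_of_rat q" "\<forall>\<^sub>F k in sequentially. \<not> u k < real_of_rat q"
      using less_cSupD[of L l] by (auto simp: L_def)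
    then show "\<forall>\<^sub>F k in sequentially. l < u k" by (auto elim: eventually_mono)
  next
    fix l assume "Sup L < l"
    then obtain q where q: "Sup L < real_of_rat q" "real_of_rat q < l" using of_rat_dense by blast
    have "bdd_above L"
    proof (rule bdd_aboveI)
      fix t assume "t \<in> L"
      then obtain k where "t \<le> u k" by (auto simp: L_def eventually_sequentially not_less)
      then show "t \<le> b" using range[of k] by simp
    qed
    then have "real_of_rat q \<notin> L" using q(1) cSup_upper by fastforce
    then have "\<forall>\<^sub>F k in sequentially. u k < real_of_rat q" using decided[of q] by (auto simp: L_def)
    then show "\<forall>\<^sub>F k in sequentially. u k < l" by (rule eventually_mono) (use q(2) in simp)
  qed
  then show ?thesis by (rule convergentI)
qed

lemma diagonal_cauchy_subsequence:
  assumes cauchy: "\<And>i::nat. cauchy_wrt (\<rho> i) (X i)"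
  obtains r :: "nat \<Rightarrow> nat"
    where "strict_mono r" "\<And>i k. i \<le> k \<Longrightarrow> \<rho> i (X i (r k)) (X i (r (Suc k))) < (1/2) ^ k"
proof -
  have "\<exists>N. \<forall>i\<le>k. \<forall>p\<ge>N. \<forall>n\<ge>N. \<rho> i (X i p) (X i n) < (1/2) ^ k" for k
  proof -
    have "\<forall>i. \<exists>N. \<forall>p\<ge>N. \<forall>n\<ge>N. \<rho> i (X i p) (X i n) < (1/2) ^ k"
      using cauchy unfolding cauchy_wrt_def by simp
    then obtain N where close: "\<And>i p n. N i \<le> p \<Longrightarrow> N i \<le> n \<Longrightarrow> \<rho> i (X i p) (X i n) < (1/2) ^ k"
      by metis
    have "N i \<le> Max (N ` {..k})" if "i \<le> k" for i using that by simp
    then show ?thesis by (meson close order_trans)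
  qed
  then obtain N where close: "\<And>k i p n. i \<le> k \<Longrightarrow> N k \<le> p \<Longrightarrow> N k \<le> n \<Longrightarrow> \<rho> i (X i p) (X i n) < (1/2) ^ k"
    by metis
  define r where "r k = (\<Sum>j\<le>k. N j) + k" for k
  have N_le_r: "N k \<le> r k" "N k \<le> r (Suc k)" for k
    unfolding r_def using member_le_sum[of k "{..k}" N] by simp_all
  show ?thesis
  proof
    show "strict_mono r" by (simp add: strict_mono_Suc_iff r_def)
    show "\<rho> i (X i (r k)) (X i (r (Suc k))) < (1/2) ^ k" if "i \<le> k" for i k
      by (rule close[OF that N_le_r])
  qed
qed

context prob_space
begin

lemma AE_convergent_subsequence_if_cauchy_cuts:
  fixes F :: "nat \<Rightarrow> 'a \<Rightarrow> real"
  assumes [measurable]: "\<And>n. F n \<in> borel_measurable M" and range: "\<And>n x. F n x \<in> {a..b}"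
    and cauchy: "\<And>q. cauchy_wrt (sdist M) (\<lambda>n. {x \<in> space M. F n x < real_of_rat q})"
  obtains r :: "nat \<Rightarrow> nat" where "strict_mono r" "AE x in M. convergent (\<lambda>k. F (r k) x)"
proof -
  define E where "E i n = {x \<in> space M. F n x < real_of_rat (from_nat i)}" for i n
  have E [measurable]: "E i n \<in> sets M" for i n unfolding E_def by measurable
  have "cauchy_wrt (sdist M) (E i)" for i unfolding E_def by (rule cauchy)
  then obtain r where r: "strict_mono r"
    and small: "\<And>i k. i \<le> k \<Longrightarrow> sdist M (E i (r k)) (E i (r (Suc k))) < (1/2) ^ k"
    using diagonal_cauchy_subsequence[of "\<lambda>i. sdist M" E] by blast
  have "AE x in M. (\<forall>\<^sub>F k in sequentially. x \<in> E i (r k)) \<or>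
      (\<forall>\<^sub>F k in sequentially. x \<notin> E i (r k))" for i
  proof (rule AE_eventually_const_if_summable_sdist)
    show "summable (\<lambda>k. sdist M (E i (r k)) (E i (r (Suc k))))"
    proof (rule summable_comparison_test')
      show "summable (\<lambda>k. (1/2::real) ^ k)" by (rule summable_geometric) simp
      show "norm (sdist M (E i (r k)) (E i (r (Suc k)))) \<le> (1/2) ^ k" if "i \<le> k" for k
        using small[OF that] by simp
    qed
  qed simp
  then have "AE x in M. \<forall>i. (\<forall>\<^sub>F k in sequentially. x \<in> E i (r k)) \<or>
      (\<forall>\<^sub>F k in sequentially. x \<notin> E i (r k))"
    by (simp add: AE_all_countable)
  then have "AE x in M. convergent (\<lambda>k. F (r k) x)"
    using AE_space
  proof eventually_elim
    case (elim x)
    have "(\<forall>\<^sub>F k in sequentially. F (r k) x < real_of_rat q) \<or>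
        (\<forall>\<^sub>F k in sequentially. \<not> F (r k) x < real_of_rat q)" for q
      using elim(1)[rule_format, of "to_nat q"] elim(2) by (simp add: E_def)
    then show ?case using range by (intro convergent_if_rat_cuts_decided[where a = a and b = b])
  qed
  with r show ?thesis by (rule that)
qed

lemma distr_eq_if_AE_tendsto:
  fixes F :: "nat \<Rightarrow> 'a \<Rightarrow> real"
  assumes [measurable]: "\<And>k. F k \<in> borel_measurable M" "G \<in> borel_measurable M"
    and distr: "\<And>k. distr M borel (F k) = D"
    and lim: "AE x in M. (\<lambda>k. F k x) \<longlonglongrightarrow> G x"
  shows "distr M borel G = D"
proof (rule Levy_uniqueness)
  show "real_distribution (distr M borel G)" by simp
  show "real_distribution D" unfolding distr[of 0, symmetric] by simp
  have char_distr: "char (distr M borel H) t = (CLINT x|M. iexp (t * H x))"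
    if "H \<in> borel_measurable M" for H t
    unfolding char_def using that by (subst integral_distr) auto
  show "char (distr M borel G) = char D"
  proof
    fix t
    have "(\<lambda>k. CLINT x|M. iexp (t * F k x)) \<longlonglongrightarrow> (CLINT x|M. iexp (t * G x))"
    proof (rule integral_dominated_convergence[where w = "\<lambda>_. 1"])
      show "AE x in M. (\<lambda>k. iexp (t * F k x)) \<longlonglongrightarrow> iexp (t * G x)"
        using lim by eventually_elim (auto intro!: tendsto_intros)
    qed auto
    moreover have "(CLINT x|M. iexp (t * F k x)) = char D t" for k
      using char_distr[of "F k" t] by (simp add: distr)
    ultimately show "char (distr M borel G) t = char D t"
      by (simp add: char_distr LIMSEQ_const_iff)
  qed
qed

lemma measure_tendsto_0_if_AE_eventually_notin:
  assumes [measurable]: "\<And>k. E k \<in> sets M" and "AE x in M. \<forall>\<^sub>F k in sequentially. x \<notin> E k"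
  shows "(\<lambda>k. measure M (E k)) \<longlonglongrightarrow> 0"
proof -
  have "(\<lambda>k. \<integral>x. indicator (E k) x \<partial>M) \<longlonglongrightarrow> (\<integral>x. (0::real) \<partial>M)"
  proof (rule integral_dominated_convergence[where w = "\<lambda>_. 1"])
    show "AE x in M. (\<lambda>k. indicator (E k) x) \<longlonglongrightarrow> (0::real)"
      using assms(2)
    proof eventually_elim
      case (elim x)
      then have "\<forall>\<^sub>F k in sequentially. indicator (E k) x = (0::real)" by eventually_elim simp
      then show ?case by (rule tendsto_eventually)
    qed
  qed (auto simp: indicator_def)
  then show ?thesis by simp
qed

text \<open>If \<open>G x\<close> lies in an open set, so do almost all \<open>F k x\<close>; as all these events have the same
  probability, this one-sided statement already gives convergence.\<close>

lemma sdist_vimage_open_tendsto_0: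
  fixes F :: "nat \<Rightarrow> 'a \<Rightarrow> real"
  assumes [measurable]: "\<And>k. F k \<in> borel_measurable M" "G \<in> borel_measurable M"
    and distr: "\<And>k. distr M borel (F k) = distr M borel G"
    and lim: "AE x in M. (\<lambda>k. F k x) \<longlonglongrightarrow> G x" and W: "open W"
  shows "(\<lambda>k. sdist M (F k -` W \<inter> space M) (G -` W \<inter> space M)) \<longlonglongrightarrow> 0"
proof -
  let ?F = "\<lambda>k. F k -` W \<inter> space M" and ?G = "G -` W \<inter> space M"
  have sets: "?F k \<in> sets M" "?G \<in> sets M" for k
    using W by (simp_all add: measurable_sets[OF assms(1)] measurable_sets[OF assms(2)])
  have "measure M (?F k) = measure M ?G" for k
  proof -
    have "measure M (?F k) = measure (distr M borel (F k)) W" using W by (simp add: measure_distr)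
    also have "\<dots> = measure M ?G" unfolding distr using W by (simp add: measure_distr)
    finally show ?thesis .
  qed
  then have "sdist M (?F k) ?G = 2 * measure M (?G - ?F k)" for k
    using sdist_eq[OF sets] finite_measure_Diff'[OF sets(2,1), of k] by (simp add: Int_commute)
  moreover
  have "(\<lambda>k. measure M (?G - ?F k)) \<longlonglongrightarrow> 0"
  proof (rule measure_tendsto_0_if_AE_eventually_notin)
    show "AE x in M. \<forall>\<^sub>F k in sequentially. x \<notin> ?G - ?F k"
      using lim
    proof eventually_elim
      case (elim x)
      show ?case
      proof (cases "G x \<in> W")
        case True
        from topological_tendstoD[OF elim W this] show ?thesis by eventually_elim simp
      qed simp
    qed
  qed (intro sets.Diff sets)
  then have "(\<lambda>k. 2 * measure M (?G - ?F k)) \<longlonglongrightarrow> 0" by (rule tendsto_mult_right_zero)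
  ultimately show ?thesis by simp
qed

end

context lebesgue_space
begin

lemma
  assumes U: "measure_preserving_map M U"
  shows coordinate_comp_measurable: "(\<lambda>x. \<phi> (U x)) \<in> borel_measurable M"
    and distr_coordinate_comp: "distr M borel (\<lambda>x. \<phi> (U x)) = distr M borel \<phi>"
proof -
  have [measurable]: "U \<in> M \<rightarrow>\<^sub>M M" and "distr M M U = M"
    using U by (simp_all add: measure_preserving_map_iff_distr)
  show "(\<lambda>x. \<phi> (U x)) \<in> borel_measurable M" by measurable
  have "distr M borel (\<lambda>x. \<phi> (U x)) = distr (distr M M U) borel \<phi>"
    by (simp add: distr_distr comp_def)
  then show "distr M borel (\<lambda>x. \<phi> (U x)) = distr M borel \<phi>" by (simp add: \<open>distr M M U = M\<close>)
qed

lemma mpt_preimg_vimage_coordinate: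
  assumes "measure_preserving_map M U"
  shows "mpt_preimg M U (\<phi> -` Z \<inter> space M) = (\<lambda>x. \<phi> (U x)) -` Z \<inter> space M"
  using measurable_space[OF measure_preserving_map_measurable[OF assms]]
  by (auto simp: mpt_preimg_def)

lemma subsequential_limit_if_cauchy:
  assumes U: "\<And>n. measure_preserving_map M (U n)"
    and cauchy: "\<And>B. B \<in> sets M \<Longrightarrow> cauchy_wrt (preimg_dist M B) U"
  obtains V r where "measure_preserving_map M V" "strict_mono (r :: nat \<Rightarrow> nat)"
    "AE x in M. (\<lambda>k. \<phi> (U (r k) x)) \<longlonglongrightarrow> \<phi> (V x)"
proof -
  note [measurable] = coordinate_comp_measurable[OF U]
  have cauchy_cuts: "cauchy_wrt (sdist M) (\<lambda>n. {x \<in> space M. \<phi> (U n x) < real_of_rat q})" for q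
  proof -
    have "{x \<in> space M. \<phi> (U n x) < real_of_rat q}
        = mpt_preimg M (U n) (\<phi> -` {..<real_of_rat q} \<inter> space M)" for n
      by (auto simp: mpt_preimg_vimage_coordinate[OF U])
    then show ?thesis
      using cauchy[of "\<phi> -` {..<real_of_rat q} \<inter> space M"] by (simp add: cauchy_wrt_def)
  qed
  obtain r :: "nat \<Rightarrow> nat" where r: "strict_mono r"
    and convergent: "AE x in M. convergent (\<lambda>k. \<phi> (U (r k) x))"
    by (rule AE_convergent_subsequence_if_cauchy_cuts[OF _ coordinate_range cauchy_cuts]) simp
  define F where "F x = lim (\<lambda>k. \<phi> (U (r k) x))" for x
  have F: "F \<in> borel_measurable M" unfolding F_def by measurable
  have F_lim: "AE x in M. (\<lambda>k. \<phi> (U (r k) x)) \<longlonglongrightarrow> F x"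
    using convergent by eventually_elim (simp add: F_def convergent_LIMSEQ_iff)
  have "distr M borel F = distr M borel \<phi>"
    by (rule distr_eq_if_AE_tendsto[OF _ F _ F_lim]) (simp_all add: distr_coordinate_comp U)
  then obtain V where V: "measure_preserving_map M V" and VF: "AE x in M. \<phi> (V x) = F x"
    using measure_preserving_map_with_coordinate[OF F] by blast
  have "AE x in M. (\<lambda>k. \<phi> (U (r k) x)) \<longlonglongrightarrow> \<phi> (V x)"
    using F_lim VF by eventually_elim simp
  with V r show ?thesis by (rule that)
qed

lemma mpt_tendsto_if_cauchy:
  assumes U: "\<And>n. measure_preserving_map M (U n)"
    and cauchy: "\<And>B. B \<in> sets M \<Longrightarrow> cauchy_wrt (preimg_dist M B) U"
  obtains V where "mpt_tendsto M U V"
proof -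
  obtain V r where V: "measure_preserving_map M V" and r: "strict_mono (r :: nat \<Rightarrow> nat)"
    and lim: "AE x in M. (\<lambda>k. \<phi> (U (r k) x)) \<longlonglongrightarrow> \<phi> (V x)"
    by (rule subsequential_limit_if_cauchy[of U, OF U cauchy])
  have "(\<lambda>n. preimg_dist M B (U n) V) \<longlonglongrightarrow> 0" if B: "B \<in> sets M" for B
  proof (rule LIMSEQ_I)
    fix e :: real assume "0 < e"
    then obtain W where W: "open W" and BW: "sdist M B (\<phi> -` W \<inter> space M) < e / 4"
      using coordinate_open_dense[OF B, of "e / 4"] by auto
    define C where "C = \<phi> -` W \<inter> space M"
    have C: "C \<in> sets M" using W unfolding C_def by measurable
    obtain N where close: "\<And>p n. N \<le> p \<Longrightarrow> N \<le> n \<Longrightarrow> preimg_dist M B (U p) (U n) < e / 4"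
      using cauchy_wrtD[OF cauchy[OF B], of "e / 4"] \<open>0 < e\<close> by auto
    have "(\<lambda>k. preimg_dist M C (U (r k)) V) \<longlonglongrightarrow> 0"
      unfolding C_def mpt_preimg_vimage_coordinate[OF U] mpt_preimg_vimage_coordinate[OF V]
      by (rule sdist_vimage_open_tendsto_0[OF _ _ _ lim W])
        (simp_all add: coordinate_comp_measurable distr_coordinate_comp U V)
    then have "\<forall>\<^sub>F k in sequentially. preimg_dist M C (U (r k)) V < e / 4"
      using \<open>0 < e\<close> by (intro order_tendstoD(2)) auto
    moreover have "\<forall>\<^sub>F k in sequentially. N \<le> r k"
      using filterlim_subseq[OF r] by (simp add: filterlim_at_top)
    ultimately have "\<forall>\<^sub>F k in sequentially. N \<le> r k \<and> preimg_dist M C (U (r k)) V < e / 4"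
      by eventually_elim simp
    then obtain k where "N \<le> r k" and limit_close: "preimg_dist M C (U (r k)) V < e / 4"
      by (auto dest: eventually_happens)
    have "preimg_dist M B (U n) V < e" if "N \<le> n" for n
      using sdist_triangle[of "mpt_preimg M (U n) B" "mpt_preimg M (U (r k)) B" "mpt_preimg M V B"]
        preimg_dist_approx[OF U V B C, of "r k"] close[OF that \<open>N \<le> r k\<close>] limit_close BW B U V
      by (simp add: C_def)
    then show "\<exists>N. \<forall>n\<ge>N. norm (preimg_dist M B (U n) V - 0) < e"
      by (intro exI[of _ N]) simp
  qed
  with U V have "mpt_tendsto M U V" by (simp add: mpt_tendsto_def)
  then show ?thesis by (rule that)
qed

end

subsection \<open>The metrics \<open>d\<close> and \<open>a\<close> on transformations\<close>

lemma AE_mpt_inv_cong: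
  assumes U: "invertible_mpt M U" and V: "invertible_mpt M V" and "AE x in M. U x = V x"
  shows "AE x in M. mpt_inv M U x = mpt_inv M V x"
proof (rule AE_mpt_inv_eq[OF U])
  show "AE x in M. mpt_inv M V (U x) = x"
    using assms(3) AE_mpt_inv_left[OF V] by eventually_elim simp
qed

context prob_space
begin

abbreviation corr :: "('a \<Rightarrow> 'a) \<Rightarrow> 'a set \<Rightarrow> 'a set \<Rightarrow> real" where
  "corr U B C \<equiv> measure M (mpt_img M U B \<inter> C)"

lemma abs_corr_diff_le_img_dist:
  assumes "invertible_mpt M U" "invertible_mpt M V" "B \<in> sets M" "C \<in> sets M"
  shows "\<bar>corr U B C - corr V B C\<bar> \<le> img_dist M B U V"
  using abs_measure_Int_diff_le_sdist[of "mpt_img M U B" "mpt_img M V B" C C] assms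
  by (simp add: bounded_pseudometric.self[OF bounded_pseudometric_sdist])

lemma abs_corr_diff_le_sdist:
  assumes "invertible_mpt M U" "B \<in> sets M" "B' \<in> sets M" "C \<in> sets M" "C' \<in> sets M"
  shows "\<bar>corr U B C - corr U B' C'\<bar> \<le> sdist M B B' + sdist M C C'"
  using abs_measure_Int_diff_le_sdist[of "mpt_img M U B" "mpt_img M U B'" C C'] assms
  by (simp add: sdist_mpt_img)

end

locale dense_family = prob_space M for M :: "'a measure" +
  fixes A :: "nat \<Rightarrow> 'a set"
  assumes sets_A [simp, intro]: "A i \<in> sets M"
    and dense_A: "B \<in> sets M \<Longrightarrow> 0 < e \<Longrightarrow> \<exists>i. sdist M B (A i) < e"
begin

definition dist_d_term :: "nat \<Rightarrow> ('a \<Rightarrow> 'a) \<Rightarrow> ('a \<Rightarrow> 'a) \<Rightarrow> real" where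
  "dist_d_term i U V = img_dist M (A i) U V + preimg_dist M (A i) U V"

definition dist_a_term :: "nat \<Rightarrow> nat \<Rightarrow> ('a \<Rightarrow> 'a) \<Rightarrow> ('a \<Rightarrow> 'a) \<Rightarrow> real" where
  "dist_a_term i j U V = \<bar>corr U (A i) (A j) - corr V (A i) (A j)\<bar>"

lemma dist_d_eq: "dist_d M A U V = dyadic_sum (\<lambda>i. dist_d_term i U V)"
  by (simp add: dist_d_def dyadic_sum_def dist_d_term_def sdist_def)

lemma dist_a_term_range: "dist_a_term i j U V \<in> {0..1}"
proof -
  have "\<bar>s - t\<bar> \<in> {0..1}" if "s \<in> {0..1}" "t \<in> {0..1}" for s t :: real
    using that by auto
  then show ?thesis by (simp add: dist_a_term_def)
qed

lemma dist_a_eq: "dist_a M A U V = dyadic_sum (\<lambda>i. dyadic_sum (\<lambda>j. dist_a_term i j U V))"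
proof -
  have "(\<Sum>j. (1/2) ^ (i + j) * dist_a_term i j U V)
      = (1/2) ^ i * dyadic_sum (\<lambda>j. dist_a_term i j U V)" for i
    using suminf_mult[OF summable_dyadic[of "\<lambda>j. dist_a_term i j U V", OF dist_a_term_range],
        of "(1/2) ^ i"]
    by (simp add: dyadic_sum_def power_add mult.assoc)
  then show ?thesis
    by (simp add: dist_a_def dyadic_sum_def[of "\<lambda>i. dyadic_sum (_ i)"] dist_a_term_def)
qed

lemma bounded_pseudometric_dist_d_term:
  "bounded_pseudometric (Collect (invertible_mpt M)) 2 (dist_d_term i)"
proof -
  have img: "bounded_pseudometric (Collect (invertible_mpt M)) 1
      (img_dist M (A i))"
    by (rule bounded_pseudometric_pullback[OF bounded_pseudometric_sdist]) simp
  have preimg: "bounded_pseudometric (Collect (invertible_mpt M)) 1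
      (preimg_dist M (A i))"
    by (rule bounded_pseudometric_pullback[OF bounded_pseudometric_sdist])
      (simp add: measure_preserving_map_if_invertible_mpt)
  show ?thesis using bounded_pseudometric_add[OF img preimg] by (simp add: dist_d_term_def[abs_def])
qed

lemma bounded_pseudometric_dist_d:
  "bounded_pseudometric (Collect (invertible_mpt M)) 4 (dist_d M A)"
  using bounded_pseudometric_dyadic_sum[OF bounded_pseudometric_dist_d_term]
  by (simp add: dist_d_eq[abs_def])

lemma bounded_pseudometric_dist_a_term:
  "bounded_pseudometric (Collect (invertible_mpt M)) 1 (dist_a_term i j)"
proof
  show "dist_a_term i j U V \<in> {0..1}" for U V by (rule dist_a_term_range)
qed (simp_all add: dist_a_term_def)

lemma bounded_pseudometric_dist_a:
  "bounded_pseudometric (Collect (invertible_mpt M)) 4 (dist_a M A)"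
  using bounded_pseudometric_dyadic_sum[OF
      bounded_pseudometric_dyadic_sum[OF bounded_pseudometric_dist_a_term]]
  by (simp add: dist_a_eq[abs_def])

lemma dist_d_term_le_dist_d:
  assumes "invertible_mpt M U" "invertible_mpt M V"
  shows "dist_d_term i U V \<le> 2 ^ i * dist_d M A U V"
  unfolding dist_d_eq
  by (rule term_le_dyadic_sum[OF bounded_pseudometric.range[OF bounded_pseudometric_dist_d_term]])
    (simp_all add: assms)

lemma img_dist_le_dist_d:
  assumes "invertible_mpt M U" "invertible_mpt M V"
  shows "img_dist M (A i) U V \<le> 2 ^ i * dist_d M A U V"
  using dist_d_term_le_dist_d[OF assms, of i]
    sdist_nonneg[of M "mpt_preimg M U (A i)" "mpt_preimg M V (A i)"]
  unfolding dist_d_term_def by linarith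

lemma preimg_dist_le_dist_d:
  assumes "invertible_mpt M U" "invertible_mpt M V"
  shows "preimg_dist M (A i) U V \<le> 2 ^ i * dist_d M A U V"
  using dist_d_term_le_dist_d[OF assms, of i]
    sdist_nonneg[of M "mpt_img M U (A i)" "mpt_img M V (A i)"]
  unfolding dist_d_term_def by linarith

lemma dist_a_term_le_dist_a:
  assumes "invertible_mpt M U" "invertible_mpt M V"
  shows "dist_a_term i j U V \<le> 2 ^ (i + j) * dist_a M A U V"
proof -
  have UV: "U \<in> Collect (invertible_mpt M)" "V \<in> Collect (invertible_mpt M)" using assms by simp_all
  have "dist_a_term i j U V \<le> 2 ^ j * dyadic_sum (\<lambda>j. dist_a_term i j U V)"
    by (rule term_le_dyadic_sum[OF dist_a_term_range])
  also have "dyadic_sum (\<lambda>j. dist_a_term i j U V) \<le> 2 ^ i * dist_a M A U V"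
    unfolding dist_a_eq
    by (rule term_le_dyadic_sum[OF bounded_pseudometric.range[OF
          bounded_pseudometric_dyadic_sum[OF bounded_pseudometric_dist_a_term] UV]])
  finally show ?thesis by (simp add: power_add mult_ac)
qed

lemma dist_a_term_le_img_dist:
  assumes "invertible_mpt M U" "invertible_mpt M V"
  shows "dist_a_term i j U V \<le> img_dist M (A i) U V"
  unfolding dist_a_term_def using assms by (intro abs_corr_diff_le_img_dist) auto

lemma
  assumes U: "\<And>n. invertible_mpt M (U n)" and V: "invertible_mpt M V"
    and lim: "mpt_tendsto M U V"
    and lim_inv: "mpt_tendsto M (\<lambda>n. mpt_inv M (U n)) (mpt_inv M V)"
  shows dist_d_tendsto_0: "(\<lambda>n. dist_d M A (U n) V) \<longlonglongrightarrow> 0"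
    and dist_a_tendsto_0: "(\<lambda>n. dist_a M A (U n) V) \<longlonglongrightarrow> 0"
proof -
  have UV: "U n \<in> Collect (invertible_mpt M)" "V \<in> Collect (invertible_mpt M)" for n
    using U V by simp_all
  have img_lim: "(\<lambda>n. img_dist M (A i) (U n) V) \<longlonglongrightarrow> 0" for i
    unfolding mpt_img_eq_mpt_preimg by (rule mpt_tendsto_preimg_dist[OF lim_inv sets_A])
  show "(\<lambda>n. dist_d M A (U n) V) \<longlonglongrightarrow> 0"
    unfolding dist_d_eq
  proof (rule dyadic_sum_tendsto_0)
    show "dist_d_term i (U n) V \<in> {0..2}" for n i
      by (rule bounded_pseudometric.range[OF bounded_pseudometric_dist_d_term UV])
    show "(\<lambda>n. dist_d_term i (U n) V) \<longlonglongrightarrow> 0" for i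
      unfolding dist_d_term_def
      by (rule tendsto_add_zero[OF img_lim mpt_tendsto_preimg_dist[OF lim sets_A]])
  qed
  have "(\<lambda>n. dist_a_term i j (U n) V) \<longlonglongrightarrow> 0" for i j
  proof (rule Lim_null_comparison[OF _ img_lim[of i]])
    have "norm (dist_a_term i j (U n) V) \<le> img_dist M (A i) (U n) V" for n
      using dist_a_term_range[of i j "U n" V] dist_a_term_le_img_dist[OF U V] by simp
    then show "\<forall>\<^sub>F n in sequentially. norm (dist_a_term i j (U n) V) \<le> img_dist M (A i) (U n) V"
      by simp
  qed
  then have "(\<lambda>n. dyadic_sum (\<lambda>j. dist_a_term i j (U n) V)) \<longlonglongrightarrow> 0" for i
    by (rule dyadic_sum_tendsto_0[OF dist_a_term_range])
  then show "(\<lambda>n. dist_a M A (U n) V) \<longlonglongrightarrow> 0"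
    unfolding dist_a_eq
    by (rule dyadic_sum_tendsto_0[OF bounded_pseudometric.range[OF
          bounded_pseudometric_dyadic_sum[OF bounded_pseudometric_dist_a_term] UV]])
qed

lemma
  assumes U: "invertible_mpt M U" and V: "invertible_mpt M V" and eq: "AE x in M. U x = V x"
  shows dist_d_eq_0_if_AE_eq: "dist_d M A U V = 0" and dist_a_eq_0_if_AE_eq: "dist_a M A U V = 0"
proof -
  have img: "img_dist M (A i) U V = 0" for i
    unfolding mpt_img_eq_mpt_preimg
    using sdist_mpt_preimg_cong_AE[of _ "mpt_inv M V" "mpt_inv M V" "mpt_inv M V" "A i" "A i"]
      AE_mpt_inv_cong[OF U V eq] measure_preserving_map_mpt_inv[OF U]
      measure_preserving_map_mpt_inv[OF V]
    by (simp add: bounded_pseudometric.self[OF bounded_pseudometric_sdist])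
  have preimg: "preimg_dist M (A i) U V = 0" for i
    using sdist_mpt_preimg_cong_AE[of U V V V "A i" "A i"] eq
      measure_preserving_map_if_invertible_mpt[OF U] measure_preserving_map_if_invertible_mpt[OF V]
    by (simp add: bounded_pseudometric.self[OF bounded_pseudometric_sdist])
  show "dist_d M A U V = 0" by (simp add: dist_d_eq dist_d_term_def img preimg dyadic_sum_const)
  have "dist_a_term i j U V = 0" for i j
    using dist_a_term_le_img_dist[OF U V, of i j] dist_a_term_range[of i j U V]
    by (simp add: img)
  then show "dist_a M A U V = 0" by (simp add: dist_a_eq dyadic_sum_const)
qed

lemma cauchy_preimg_dist_if_cauchy_dense:
  assumes U: "\<And>n. measure_preserving_map M (U n)"
    and cauchy: "\<And>i. cauchy_wrt (preimg_dist M (A i)) U" and B: "B \<in> sets M"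
  shows "cauchy_wrt (preimg_dist M B) U"
  unfolding cauchy_wrt_def
proof (intro allI impI)
  fix e :: real assume "0 < e"
  then obtain i where near: "sdist M B (A i) < e / 4" using dense_A[OF B, of "e / 4"] by auto
  obtain N where close: "\<And>p n. N \<le> p \<Longrightarrow> N \<le> n \<Longrightarrow> preimg_dist M (A i) (U p) (U n) < e / 2"
    using cauchy_wrtD[OF cauchy, of "e / 2"] \<open>0 < e\<close> by auto
  have "preimg_dist M B (U p) (U n) < e" if "N \<le> p" "N \<le> n" for p n
    using preimg_dist_approx[OF U U B sets_A[of i], of p n] near close[OF that] by linarith
  then show "\<exists>N. \<forall>p\<ge>N. \<forall>n\<ge>N. preimg_dist M B (U p) (U n) < e" by blast
qed

lemma preimg_dist_eq_0_if_dist_d_eq_0: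
  assumes U: "invertible_mpt M U" and V: "invertible_mpt M V" and "dist_d M A U V = 0"
    and B: "B \<in> sets M"
  shows "preimg_dist M B U V = 0"
proof (rule antisym)
  note U_mp = measure_preserving_map_if_invertible_mpt[OF U]
    and V_mp = measure_preserving_map_if_invertible_mpt[OF V]
  have dense: "preimg_dist M (A i) U V \<le> 0" for i
    using preimg_dist_le_dist_d[OF U V, of i] assms(3) by simp
  show "preimg_dist M B U V \<le> 0"
  proof (rule field_le_epsilon)
    fix e :: real assume "0 < e"
    then obtain i where "sdist M B (A i) < e / 2" using dense_A[OF B, of "e / 2"] by auto
    then show "preimg_dist M B U V \<le> 0 + e"
      using preimg_dist_approx[OF U_mp V_mp B sets_A[of i]] dense[of i] by linarith
  qed
qed simp

lemma abs_corr_diff_le_dist_d: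
  assumes U: "invertible_mpt M U" and V: "invertible_mpt M V"
    and B: "B \<in> sets M" and "C \<in> sets M"
  shows "\<bar>corr U B C - corr V B C\<bar> \<le> 2 * sdist M B (A i) + 2 ^ i * dist_d M A U V"
proof -
  have "\<bar>corr U B C - corr V B C\<bar> \<le> img_dist M B U V"
    by (rule abs_corr_diff_le_img_dist[OF assms])
  also have "\<dots> \<le> 2 * sdist M B (A i) + img_dist M (A i) U V"
    unfolding mpt_img_eq_mpt_preimg
    using U V B by (intro preimg_dist_approx measure_preserving_map_mpt_inv) auto
  finally show ?thesis using img_dist_le_dist_d[OF U V, of i] by linarith
qed

lemma abs_corr_diff_le_dist_a:
  assumes U: "invertible_mpt M U" and V: "invertible_mpt M V"
    and B: "B \<in> sets M" and C: "C \<in> sets M"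
  shows "\<bar>corr U B C - corr V B C\<bar>
    \<le> 2 * sdist M B (A i) + 2 * sdist M C (A j) + 2 ^ (i + j) * dist_a M A U V"
  using abs_corr_diff_le_sdist[OF U B sets_A[of i] C sets_A[of j]]
    abs_corr_diff_le_sdist[OF V B sets_A[of i] C sets_A[of j]] dist_a_term_le_dist_a[OF U V, of i j]
  unfolding dist_a_term_def by linarith

end

subsection \<open>Topological groups\<close>

definition topological_group :: "'g::{group_add,topological_space} itself \<Rightarrow> bool" where
  "topological_group _ \<longleftrightarrow> continuous_on UNIV (\<lambda>p::'g \<times> 'g. fst p + snd p) \<and>
     continuous_on UNIV (uminus :: 'g \<Rightarrow> 'g)"

context
  assumes topological_group: "topological_group TYPE('g::{group_add,topological_space})"
begin

lemma continuous_on_group_add: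
  fixes f g :: "'x::topological_space \<Rightarrow> 'g"
  assumes "continuous_on S f" "continuous_on S g"
  shows "continuous_on S (\<lambda>x. f x + g x)"
proof -
  have "continuous_on UNIV (\<lambda>p::'g \<times> 'g. fst p + snd p)"
    using topological_group by (simp add: topological_group_def)
  from continuous_on_compose2[OF this continuous_on_Pair[OF assms]] show ?thesis by simp
qed

lemma continuous_on_group_minus:
  fixes f :: "'x::topological_space \<Rightarrow> 'g"
  assumes "continuous_on S f"
  shows "continuous_on S (\<lambda>x. - f x)"
proof -
  have "continuous_on UNIV (uminus :: 'g \<Rightarrow> 'g)"
    using topological_group by (simp add: topological_group_def)
  from continuous_on_compose2[OF this assms] show ?thesis by simp
qed

lemma continuous_on_left_translation: "continuous_on UNIV ((+) (a :: 'g))"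
  by (rule continuous_on_group_add[OF continuous_on_const continuous_on_id, simplified])

lemma open_left_translate:
  assumes "open V"
  shows "open ((+) (a :: 'g) ` V)"
proof -
  have "(+) a ` V = (+) (- a) -` V"
    by (auto simp: image_iff intro!: bexI[where x = "- a + _"])
  then show ?thesis using open_vimage[OF assms continuous_on_left_translation] by simp
qed

lemma open_neighbourhood_translates_subset:
  assumes W: "open W" and x: "(x :: 'g) \<in> W"
  obtains U where "open U" "0 \<in> U" "\<And>y. x \<in> (+) y ` U \<Longrightarrow> (+) y ` U \<subseteq> W"
proof -
  let ?f = "\<lambda>p::'g \<times> 'g. x + (- fst p + snd p)"
  have "continuous_on UNIV ?f"
    by (intro continuous_on_group_add continuous_on_group_minus continuous_on_const
        continuous_on_fst continuous_on_snd continuous_on_id)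
  then have "open (?f -` W)" by (rule open_vimage[OF W])
  moreover have "(0, 0) \<in> ?f -` W" using x by simp
  ultimately obtain P Q where PQ: "open P" "open Q" "0 \<in> P" "0 \<in> Q" "P \<times> Q \<subseteq> ?f -` W"
    by (auto elim!: open_prod_elim)
  show ?thesis
  proof
    show "open (P \<inter> Q)" "0 \<in> P \<inter> Q" using PQ by auto
    fix y assume "x \<in> (+) y ` (P \<inter> Q)"
    then obtain v where v: "v \<in> P \<inter> Q" "x = y + v" by blast
    have "y + w \<in> W" if "w \<in> P \<inter> Q" for w
    proof -
      have "x + (- v + w) \<in> W" using PQ(5) v(1) that by auto
      then show ?thesis by (simp add: v(2) add.assoc)
    qed
    then show "(+) y ` (P \<inter> Q) \<subseteq> W" by blast
  qed
qed

lemma countable_translates_cover: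
  fixes C :: "nat \<Rightarrow> 'g set"
  assumes C: "\<And>n. compact (C n)" "(\<Union>n. C n) = UNIV" and V: "open V" "0 \<in> V"
  obtains D :: "'g set" where "countable D" "(\<Union>x\<in>D. (+) x ` V) = UNIV"
proof -
  have "\<exists>D. finite D \<and> C n \<subseteq> (\<Union>x\<in>D. (+) x ` V)" for n
  proof -
    have "x \<in> (+) x ` V" for x using V(2) by (intro image_eqI[of _ _ 0]) auto
    then have "C n \<subseteq> (\<Union>x\<in>C n. (+) x ` V)" by blast
    from compactE_image[OF C(1)[of n] open_left_translate[OF V(1)] this]
    obtain D where "finite D" "C n \<subseteq> (\<Union>x\<in>D. (+) x ` V)" .
    then show ?thesis by blast
  qed
  then obtain D where D: "\<And>n. finite (D n)" "\<And>n. C n \<subseteq> (\<Union>x\<in>D n. (+) x ` V)" by metis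
  show ?thesis
  proof
    show "countable (\<Union>n. D n)" using D(1) by (simp add: countable_finite)
    have "(\<Union>n. C n) \<subseteq> (\<Union>x\<in>(\<Union>n. D n). (+) x ` V)"
      by (intro UN_least order_trans[OF D(2)] UN_mono) auto
    then show "(\<Union>x\<in>(\<Union>n. D n). (+) x ` V) = UNIV" by (simp add: C(2) top.extremum_unique)
  qed
qed

end

lemma second_countable_if_sigma_compact:
  fixes C :: "nat \<Rightarrow> 'g::{group_add,first_countable_topology} set"
  assumes group: "topological_group TYPE('g)" and C: "\<And>n. compact (C n)" "(\<Union>n. C n) = UNIV"
  obtains \<B> :: "'g set set" where "countable \<B>" "topological_basis \<B>"
proof -
  obtain \<V> :: "'g set set" where \<V>: "countable \<V>" "\<And>V. V \<in> \<V> \<Longrightarrow> 0 \<in> V" "\<And>V. V \<in> \<V> \<Longrightarrow> open V"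
    and \<V>_base: "\<And>S. open S \<Longrightarrow> 0 \<in> S \<Longrightarrow> \<exists>V\<in>\<V>. V \<subseteq> S"
    by (rule first_countable_basisE[of "0::'g"]) blast
  have "\<exists>D. countable D \<and> (\<Union>x\<in>D. (+) x ` V) = UNIV" if "V \<in> \<V>" for V
    using countable_translates_cover[OF group C \<V>(3)[OF that] \<V>(2)[OF that]] by metis
  then obtain D where D: "\<And>V. V \<in> \<V> \<Longrightarrow> countable (D V)" "\<And>V. V \<in> \<V> \<Longrightarrow> (\<Union>x\<in>D V. (+) x ` V) = UNIV"
    by metis
  define \<B> where "\<B> = (\<Union>V\<in>\<V>. (\<lambda>x. (+) x ` V) ` D V)"
  have "topological_basis \<B>"
  proof (rule topological_basisI)
    show "open B" if "B \<in> \<B>" for B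
      using that \<V>(3) open_left_translate[OF group] by (auto simp: \<B>_def)
    fix W :: "'g set" and x assume W: "open W" "x \<in> W"
    obtain U where U: "open U" "0 \<in> U" and small: "\<And>y. x \<in> (+) y ` U \<Longrightarrow> (+) y ` U \<subseteq> W"
      using open_neighbourhood_translates_subset[OF group W] by blast
    obtain V where V: "V \<in> \<V>" "V \<subseteq> U" using \<V>_base[OF U] by blast
    obtain y where y: "y \<in> D V" "x \<in> (+) y ` V" using D(2)[OF V(1)] by blast
    have "(+) y ` V \<subseteq> W" using small[of y] y(2) V(2) by blast
    moreover have "(+) y ` V \<in> \<B>" using V(1) y(1) by (auto simp: \<B>_def)
    ultimately show "\<exists>B\<in>\<B>. x \<in> B \<and> B \<subseteq> W" using y(2) by blast
  qed
  moreover have "countable \<B>" unfolding \<B>_def using \<V>(1) D(1)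
    by (intro countable_UN countable_image)
  ultimately show ?thesis using that by blast
qed

lemma generated_subgroup_subset:
  "S \<subseteq> H \<Longrightarrow> is_subgroup H \<Longrightarrow> generated_subgroup S \<subseteq> H"
  unfolding generated_subgroup_def by blast

lemma generated_subgroup_mono:
  "S \<subseteq> S' \<Longrightarrow> generated_subgroup S \<subseteq> generated_subgroup S'"
  unfolding generated_subgroup_def by (intro Inter_anti_mono) auto

lemma is_subgroup_if_diff_closed:
  assumes zero: "0 \<in> H" and diff: "\<And>x y. x \<in> H \<Longrightarrow> y \<in> H \<Longrightarrow> x - y \<in> H"
  shows "is_subgroup H"
proof -
  have minus: "- x \<in> H" if "x \<in> H" for x using diff[OF zero that] by simp
  moreover have "x + y \<in> H" if "x \<in> H" "y \<in> H" for x y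
    using diff[OF that(1) minus[OF that(2)]] by simp
  ultimately show ?thesis using zero by (simp add: is_subgroup_def)
qed

lemma sigma_compact_if_generated:
  fixes L :: "nat \<Rightarrow> 'g::{group_add,topological_space} set"
  assumes group: "topological_group TYPE('g)" and L: "\<And>n. compact (L n)"
    and generated: "generated_subgroup (\<Union>n. L n) = UNIV"
  obtains C :: "nat \<Rightarrow> 'g set" where "\<And>n. compact (C n)" "(\<Union>n. C n) = UNIV"
proof -
  define C where "C = rec_nat {0} (\<lambda>n Z. (\<lambda>p. fst p - snd p) ` ((Z \<union> L n) \<times> (Z \<union> L n)))"
  have C_Suc: "C (Suc n) = (\<lambda>p. fst p - snd p) ` ((C n \<union> L n) \<times> (C n \<union> L n))" for n
    by (simp add: C_def)
  have compact: "compact (C n)" for n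
  proof (induction n)
    case (Suc n)
    have "continuous_on S (\<lambda>p::'g \<times> 'g. fst p - snd p)" for S
      unfolding diff_conv_add_uminus
      by (intro continuous_on_group_add[OF group] continuous_on_group_minus[OF group]
          continuous_on_fst continuous_on_snd continuous_on_id)
    then show ?case
      unfolding C_Suc using Suc L by (intro compact_continuous_image compact_Times compact_Un)
  qed (simp add: C_def)
  have diff: "x - y \<in> C (Suc n)" if "x \<in> C n \<union> L n" "y \<in> C n \<union> L n" for x y n
    unfolding C_Suc using that by (intro image_eqI[of _ _ "(x, y)"]) auto
  have zero: "0 \<in> C n" for n
  proof (induction n)
    case (Suc n)
    then show ?case using diff[of 0 n 0] by simp
  qed (simp add: C_def)
  have step: "C n \<union> L n \<subseteq> C (Suc n)" for n using diff[of _ n 0] zero[of n] by auto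
  have "is_subgroup (\<Union>n. C n)"
  proof (rule is_subgroup_if_diff_closed)
    show "0 \<in> (\<Union>n. C n)" using zero by blast
    fix x y assume "x \<in> (\<Union>n. C n)" "y \<in> (\<Union>n. C n)"
    then obtain n m where nm: "x \<in> C n" "y \<in> C m" by blast
    have "mono C" using step by (intro incseq_SucI) simp
    then have "x \<in> C (max n m)" "y \<in> C (max n m)"
      using nm monoD[of C n "max n m"] monoD[of C m "max n m"] by auto
    then show "x - y \<in> (\<Union>n. C n)" using diff[of x "max n m" y] by blast
  qed
  moreover have "(\<Union>n. L n) \<subseteq> (\<Union>n. C n)" using step by blast
  ultimately have "(\<Union>n. C n) = UNIV"
    using generated_subgroup_subset[of "\<Union>n. L n" "\<Union>n. C n"] generated
    by (simp add: top.extremum_unique)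
  with compact show ?thesis by (rule that)
qed

subsection \<open>Actions\<close>

locale mp_action = prob_space M for M :: "'a measure" +
  fixes T :: "'g::group_add \<Rightarrow> 'a \<Rightarrow> 'a"
  assumes invertible: "invertible_mpt M (T g)"
    and AE_add: "AE x in M. T g (T h x) = T (g + h) x"
begin

lemma preserving: "measure_preserving_map M (T g)"
  by (rule measure_preserving_map_if_invertible_mpt[OF invertible])

lemma AE_zero: "AE x in M. T 0 x = x"
proof -
  have "AE x in M. T 0 (T 0 x) = T 0 x" using AE_add[of 0 0] by simp
  with measure_preserving_map_AE[OF preserving AE_mpt_inv_left[OF invertible[of 0]], of 0]
    AE_mpt_inv_left[OF invertible[of 0]]
  show ?thesis by eventually_elim simp
qed

lemma AE_minus_left: "AE x in M. T (- g) (T g x) = x"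
  using AE_add[of "- g" g] AE_zero by eventually_elim simp

lemma AE_mpt_inv: "AE x in M. mpt_inv M (T g) x = T (- g) x"
  by (rule AE_mpt_inv_eq[OF invertible AE_minus_left])

lemma AE_mem_mpt_img: "AE x in M. x \<in> mpt_img M (T g) B \<longleftrightarrow> T (- g) x \<in> B"
  using AE_mpt_inv[of g] AE_space by eventually_elim (simp add: mpt_img_def)

lemma corr_translate:
  assumes B: "B \<in> sets M" and C: "C \<in> sets M"
  shows "corr (T (s + g)) B (mpt_img M (T s) C) = corr (T g) B C"
proof -
  have sets: "mpt_img M (T g) B \<in> sets M" for g using B by (simp add: invertible)
  have "corr (T (s + g)) B (mpt_img M (T s) C)
      = measure M (mpt_preimg M (T (- s)) (mpt_img M (T g) B \<inter> C))"
  proof (rule measure_eq_AE)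
    show "AE x in M. x \<in> mpt_img M (T (s + g)) B \<inter> mpt_img M (T s) C \<longleftrightarrow>
        x \<in> mpt_preimg M (T (- s)) (mpt_img M (T g) B \<inter> C)"
      using AE_mem_mpt_img[of "s + g" B] AE_mem_mpt_img[of s C] AE_add[of "- g" "- s"]
        measure_preserving_map_AE[OF preserving AE_mem_mpt_img[of g B], of "- s"] AE_space
      by eventually_elim (simp add: minus_add mpt_preimg_def)
  qed (use sets C preserving invertible in auto)
  also have "\<dots> = corr (T g) B C" using sets C by (intro measure_mpt_preimg[OF preserving]) auto
  finally show ?thesis .
qed

end

lemma preimg_dist_action:
  assumes "mp_action M T" "mp_action M S" "B \<in> sets M"
  shows "preimg_dist M B (T g) (S g) = img_dist M B (T (- g)) (S (- g))"
proof -
  interpret T: mp_action M T + S: mp_action M S by fact+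
  have "AE x in M. T g x = mpt_inv M (T (- g)) x" "AE x in M. S g x = mpt_inv M (S (- g)) x"
    using T.AE_mpt_inv[of "- g"] S.AE_mpt_inv[of "- g"] by (eventually_elim, simp)+
  then show ?thesis
    unfolding mpt_img_eq_mpt_preimg
    using assms(3) T.preserving S.preserving T.invertible S.invertible
    by (intro T.sdist_mpt_preimg_cong_AE measure_preserving_map_mpt_inv) auto
qed

lemma is_subgroup_AE_eq:
  assumes "mp_action M T" "mp_action M S"
  shows "is_subgroup {g. AE x in M. T g x = S g x}"
  unfolding is_subgroup_def
proof (intro conjI ballI; unfold mem_Collect_eq)
  interpret T: mp_action M T + S: mp_action M S by fact+
  show "AE x in M. T 0 x = S 0 x" using T.AE_zero S.AE_zero by eventually_elim simp
  fix g assume g: "AE x in M. T g x = S g x"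
  have "AE x in M. T g (T (- g) x) = x" using T.AE_minus_left[of "- g"] by simp
  with measure_preserving_map_AE[OF T.preserving[of "- g"] g]
    measure_preserving_map_AE[OF T.preserving[of "- g"] S.AE_minus_left[of g]]
  show "AE x in M. T (- g) x = S (- g) x" by eventually_elim metis
  fix h assume h: "AE x in M. T h x = S h x"
  from h measure_preserving_map_AE[OF S.preserving[of h] g] T.AE_add[of g h] S.AE_add[of g h]
  show "AE x in M. T (g + h) x = S (g + h) x" by eventually_elim metis
qed

context prob_space
begin

lemma is_action_iff:
  "is_action M T \<longleftrightarrow> mp_action M T \<and>
     (\<forall>B\<in>sets M. \<forall>C\<in>sets M. continuous_on UNIV (\<lambda>g. corr (T g) B C))"
  by (auto simp: is_action_def mp_action_def mp_action_axioms_def prob_space_axioms)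

text \<open>Translation invariance of correlations spreads continuity from one open set to the group.\<close>

lemma is_action_if_continuous_on_interior:
  fixes T :: "'g::{group_add,topological_space} \<Rightarrow> 'a \<Rightarrow> 'a"
  assumes group: "topological_group TYPE('g)" and T: "mp_action M T"
    and cont: "\<And>B C. B \<in> sets M \<Longrightarrow> C \<in> sets M \<Longrightarrow> continuous_on Z (\<lambda>g. corr (T g) B C)"
    and Z: "interior Z \<noteq> {}"
  shows "is_action M T"
proof -
  interpret mp_action M T by (rule T)
  obtain g0 where g0: "g0 \<in> interior Z" using Z by blast
  have "continuous_on UNIV (\<lambda>g. corr (T g) B C)" if B: "B \<in> sets M" and C: "C \<in> sets M" for B C
  proof -
    have "continuous_on (\<Union>s. (+) s -` interior Z) (\<lambda>g. corr (T g) B C)"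
    proof (rule continuous_on_open_UN)
      fix s
      show "open ((+) s -` interior Z)"
        by (intro open_vimage continuous_on_left_translation[OF group] open_interior)
      have "mpt_img M (T s) C \<in> sets M" using C by (simp add: invertible)
      then have "continuous_on Z (\<lambda>g. corr (T g) B (mpt_img M (T s) C))" by (rule cont[OF B])
      then have "continuous_on ((+) s -` interior Z) (\<lambda>g. corr (T (s + g)) B (mpt_img M (T s) C))"
        using interior_subset
        by (intro continuous_on_compose2[OF _
              continuous_on_subset[OF continuous_on_left_translation[OF group]]]) auto
      then show "continuous_on ((+) s -` interior Z) (\<lambda>g. corr (T g) B C)"
        by (simp add: corr_translate B C)
    qed
    moreover have "(\<Union>s. (+) s -` interior Z) = UNIV"
    proof -
      have "g \<in> (+) (g0 - g) -` interior Z" for g using g0 by simp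
      then show ?thesis by blast
    qed
    ultimately show ?thesis by simp
  qed
  with T show ?thesis by (simp add: is_action_iff)
qed

lemma mpt_tendsto_add_action:
  assumes X: "\<And>n. mp_action M (X n)"
    and g: "mpt_tendsto M (\<lambda>n. X n g) U" and h: "mpt_tendsto M (\<lambda>n. X n h) V"
  shows "mpt_tendsto M (\<lambda>n. X n (g + h)) (\<lambda>x. U (V x))"
proof (rule mpt_tendsto_cong_AE[OF mpt_tendsto_comp[OF g h]])
  show "measure_preserving_map M (X n (g + h))" for n by (rule mp_action.preserving[OF X])
  show "AE x in M. X n g (X n h x) = X n (g + h) x" for n by (rule mp_action.AE_add[OF X])
  show "measure_preserving_map M (\<lambda>x. U (V x))"
    by (rule measure_preserving_map_comp[OF mpt_tendsto_limit_preserving[OF g]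
          mpt_tendsto_limit_preserving[OF h]])
qed simp

lemma mpt_tendsto_zero_action:
  assumes X: "\<And>n. mp_action M (X n)"
  shows "mpt_tendsto M (\<lambda>n. X n 0) (\<lambda>x. x)"
proof (rule mpt_tendsto_cong_AE[OF mpt_tendsto_const[OF measure_preserving_map_id]])
  show "measure_preserving_map M (X n 0)" for n by (rule mp_action.preserving[OF X])
  show "AE x in M. x = X n 0 x" for n
    using mp_action.AE_zero[OF X[of n]] by eventually_elim simp
qed (simp_all add: measure_preserving_map_id)

lemma is_subgroup_convergent:
  assumes X: "\<And>n. mp_action M (X n)"
  shows "is_subgroup {g. (\<exists>U. mpt_tendsto M (\<lambda>n. X n g) U) \<and> (\<exists>U. mpt_tendsto M (\<lambda>n. X n (- g)) U)}"
  unfolding is_subgroup_def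
  using mpt_tendsto_zero_action[of X, OF X] mpt_tendsto_add_action[of X, OF X]
  by (simp add: minus_add del: add_uminus_conv_diff) blast

lemma mpt_tendsto_mpt_inv_action:
  assumes X: "\<And>n. mp_action M (X n)" and V: "mp_action M V"
    and lim: "mpt_tendsto M (\<lambda>n. X n (- g)) (V (- g))"
  shows "mpt_tendsto M (\<lambda>n. mpt_inv M (X n g)) (mpt_inv M (V g))"
proof (rule mpt_tendsto_cong_AE[OF lim])
  show "AE x in M. X n (- g) x = mpt_inv M (X n g) x" for n
    using mp_action.AE_mpt_inv[OF X, of n g] by eventually_elim simp
  show "AE x in M. V (- g) x = mpt_inv M (V g) x"
    using mp_action.AE_mpt_inv[OF V, of g] by eventually_elim simp
qed (intro measure_preserving_map_mpt_inv mp_action.invertible[OF X] mp_action.invertible[OF V])+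

end

lemma (in lebesgue_space) mp_action_limit:
  assumes X: "\<And>n. mp_action M (X n)" and lim: "\<And>g. mpt_tendsto M (\<lambda>n. X n g) (V g)"
  shows "mp_action M V"
proof
  show add: "AE x in M. V g (V h x) = V (g + h) x" for g h
    by (rule mpt_tendsto_unique[OF mpt_tendsto_add_action[OF X lim lim] lim])
  have "AE x in M. V 0 x = x"
    by (rule mpt_tendsto_unique[OF lim mpt_tendsto_zero_action[OF X]])
  then have inv: "AE x in M. V (- g) (V g x) = x" for g
    using add[of "- g" g] by eventually_elim simp
  show "invertible_mpt M (V g)" for g
    unfolding invertible_mpt_def
    using mpt_tendsto_limit_preserving[OF lim] inv[of g] inv[of "- g"] by auto
qed

subsection \<open>The metric on mixing actions\<close>

locale mixing_space = lebesgue_space M \<phi> \<psi> + dense_family M A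
  for M :: "'a measure" and \<phi> :: "'a \<Rightarrow> real" and \<psi> :: "real \<Rightarrow> 'a" and A :: "nat \<Rightarrow> 'a set" +
  fixes I :: "nat set" and K :: "nat \<Rightarrow> 'g::{group_add,first_countable_topology} set"
    and \<Gamma> :: "'g set"
  assumes group: "topological_group TYPE('g)"
    and compact_K: "i \<in> I \<Longrightarrow> compact (K i)"
    and interior_K: "i \<in> I \<Longrightarrow> interior (K i) \<noteq> {}"
    and generating: "generated_subgroup (\<Union>i\<in>I. K i) = UNIV"
    and unbounded_\<Gamma>: "unbounded_set \<Gamma>"
begin

abbreviation dist_m :: "('g \<Rightarrow> 'a \<Rightarrow> 'a) \<Rightarrow> ('g \<Rightarrow> 'a \<Rightarrow> 'a) \<Rightarrow> real" where
  "dist_m \<equiv> metric_m M A I K \<Gamma>"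

definition sup_d :: "nat \<Rightarrow> ('g \<Rightarrow> 'a \<Rightarrow> 'a) \<Rightarrow> ('g \<Rightarrow> 'a \<Rightarrow> 'a) \<Rightarrow> real" where
  "sup_d i T S = (if i \<in> I then SUP g\<in>K i. dist_d M A (T g) (S g) else 0)"

definition sup_a :: "('g \<Rightarrow> 'a \<Rightarrow> 'a) \<Rightarrow> ('g \<Rightarrow> 'a \<Rightarrow> 'a) \<Rightarrow> real" where
  "sup_a T S = (SUP g\<in>\<Gamma>. dist_a M A (T g) (S g))"

lemma dist_m_eq: "dist_m T S = dyadic_sum (\<lambda>i. sup_d i T S) + sup_a T S"
proof -
  have "(if i \<in> I then (1/2) ^ i * (SUP g\<in>K i. dist_d M A (T g) (S g)) else 0)
      = (1/2) ^ i * sup_d i T S" for i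
    by (simp add: sup_d_def)
  then show ?thesis by (simp add: metric_m_def dyadic_sum_def sup_a_def)
qed

lemma K_nonempty: "i \<in> I \<Longrightarrow> K i \<noteq> {}"
  using interior_K[of i] interior_subset[of "K i"] by auto

lemma \<Gamma>_nonempty: "\<Gamma> \<noteq> {}"
  using unbounded_\<Gamma> unfolding unbounded_set_def using compact_empty by blast

lemma generating_induct: "(\<Union>i\<in>I. K i) \<subseteq> H \<Longrightarrow> is_subgroup H \<Longrightarrow> g \<in> H"
  using generated_subgroup_subset[of "\<Union>i\<in>I. K i" H] generating by blast

lemma I_nonempty: "I \<noteq> {}"
proof
  assume "I = {}"
  then have "g \<in> {0}" for g :: 'g by (intro generating_induct) (auto simp: is_subgroup_def)
  then have "\<Gamma> \<subseteq> {0}" by blast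
  then show False using unbounded_\<Gamma> unfolding unbounded_set_def using compact_sing by blast
qed

lemma bounded_pseudometric_dist_d_action:
  "bounded_pseudometric (Collect (mp_action M)) 4 (\<lambda>T S. dist_d M A (T g) (S g))"
  by (rule bounded_pseudometric_pullback[OF bounded_pseudometric_dist_d])
    (simp add: mp_action.invertible)

lemma bounded_pseudometric_dist_a_action:
  "bounded_pseudometric (Collect (mp_action M)) 4 (\<lambda>T S. dist_a M A (T g) (S g))"
  by (rule bounded_pseudometric_pullback[OF bounded_pseudometric_dist_a])
    (simp add: mp_action.invertible)

lemma bounded_pseudometric_sup_d: "bounded_pseudometric (Collect (mp_action M)) 4 (sup_d i)"
  using bounded_pseudometric_SUP[OF bounded_pseudometric_dist_d_action K_nonempty, of i]
    bounded_pseudometric_zero[of 4]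
  by (cases "i \<in> I") (simp_all add: sup_d_def[abs_def])

lemma bounded_pseudometric_sup_a: "bounded_pseudometric (Collect (mp_action M)) 4 sup_a"
  using bounded_pseudometric_SUP[OF bounded_pseudometric_dist_a_action \<Gamma>_nonempty]
  by (simp add: sup_a_def[abs_def])

lemma bounded_pseudometric_dist_m: "bounded_pseudometric (Collect (mp_action M)) 12 dist_m"
  using bounded_pseudometric_add[OF bounded_pseudometric_dyadic_sum[OF bounded_pseudometric_sup_d]
      bounded_pseudometric_sup_a]
  by (simp add: dist_m_eq[abs_def])

lemma dist_d_eq_0_iff:
  assumes U: "invertible_mpt M U" and V: "invertible_mpt M V"
  shows "dist_d M A U V = 0 \<longleftrightarrow> (AE x in M. U x = V x)"
proof
  assume "dist_d M A U V = 0"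
  then show "AE x in M. U x = V x"
    using U V by (intro AE_eq_if_preimg_dist_eq_0 preimg_dist_eq_0_if_dist_d_eq_0
        measure_preserving_map_if_invertible_mpt)
qed (rule dist_d_eq_0_if_AE_eq[OF U V])

context
  fixes T S :: "'g \<Rightarrow> 'a \<Rightarrow> 'a"
  assumes T: "mp_action M T" and S: "mp_action M S"
begin

lemma dist_d_le_sup_d:
  assumes "i \<in> I" and g: "g \<in> K i"
  shows "dist_d M A (T g) (S g) \<le> sup_d i T S"
proof -
  have "dist_d M A (T g) (S g) \<le> (SUP g\<in>K i. dist_d M A (T g) (S g))"
    by (rule cSUP_upper[OF g bounded_pseudometric_bdd_above[OF bounded_pseudometric_dist_d_action]])
      (simp_all add: T S)
  then show ?thesis using \<open>i \<in> I\<close> by (simp add: sup_d_def)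
qed

lemma dist_a_le_sup_a: "g \<in> \<Gamma> \<Longrightarrow> dist_a M A (T g) (S g) \<le> sup_a T S"
  unfolding sup_a_def
  by (rule cSUP_upper[OF _ bounded_pseudometric_bdd_above[OF bounded_pseudometric_dist_a_action]])
    (simp_all add: T S)

lemma sup_d_range: "sup_d i T S \<in> {0..4}"
  using T S by (intro bounded_pseudometric.range[OF bounded_pseudometric_sup_d]) simp_all

lemma sup_a_range: "sup_a T S \<in> {0..4}"
  using T S by (intro bounded_pseudometric.range[OF bounded_pseudometric_sup_a]) simp_all

lemma sup_d_le_dist_m: "sup_d i T S \<le> 2 ^ i * dist_m T S"
proof -
  have "sup_d i T S \<le> 2 ^ i * dyadic_sum (\<lambda>i. sup_d i T S)"
    by (rule term_le_dyadic_sum[OF sup_d_range])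
  also have "\<dots> \<le> 2 ^ i * dist_m T S"
    using sup_a_range by (intro mult_left_mono) (simp_all add: dist_m_eq)
  finally show ?thesis .
qed

lemma sup_a_le_dist_m: "sup_a T S \<le> dist_m T S"
  using dyadic_sum_range[of "\<lambda>i. sup_d i T S", OF sup_d_range] by (simp add: dist_m_eq)

lemma dist_d_le_dist_m: "i \<in> I \<Longrightarrow> g \<in> K i \<Longrightarrow> dist_d M A (T g) (S g) \<le> 2 ^ i * dist_m T S"
  using dist_d_le_sup_d sup_d_le_dist_m by (rule order_trans)

lemma dist_m_eq_0_iff: "dist_m T S = 0 \<longleftrightarrow> action_equiv M T S"
proof
  note inv = mp_action.invertible[OF T] mp_action.invertible[OF S]
  assume zero: "dist_m T S = 0"
  have "g \<in> {g. AE x in M. T g x = S g x}" for g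
  proof (rule generating_induct)
    show "is_subgroup {g. AE x in M. T g x = S g x}" by (rule is_subgroup_AE_eq[OF T S])
    show "(\<Union>i\<in>I. K i) \<subseteq> {g. AE x in M. T g x = S g x}"
    proof
      fix g assume "g \<in> (\<Union>i\<in>I. K i)"
      then obtain i where "i \<in> I" "g \<in> K i" by blast
      then have "dist_d M A (T g) (S g) \<le> 0" using dist_d_le_dist_m[of i g] zero by simp
      moreover have "0 \<le> dist_d M A (T g) (S g)"
        using bounded_pseudometric.range[OF bounded_pseudometric_dist_d_action, of T S g] T S
        by simp
      ultimately have "dist_d M A (T g) (S g) = 0" by (rule antisym)
      then show "g \<in> {g. AE x in M. T g x = S g x}" by (simp add: dist_d_eq_0_iff inv)
    qed
  qed
  then show "action_equiv M T S" by (simp add: action_equiv_def)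
next
  assume "action_equiv M T S"
  then have eq: "AE x in M. T g x = S g x" for g by (simp add: action_equiv_def)
  note inv = mp_action.invertible[OF T] mp_action.invertible[OF S]
  have "sup_d i T S = 0" for i
    using K_nonempty[of i] by (simp add: sup_d_def dist_d_eq_0_if_AE_eq[OF inv eq])
  moreover have "sup_a T S = 0"
    using \<Gamma>_nonempty by (simp add: sup_a_def dist_a_eq_0_if_AE_eq[OF inv eq])
  ultimately show "dist_m T S = 0" by (simp add: dist_m_eq dyadic_sum_const)
qed

end

end

subsection \<open>Completeness\<close>

context mixing_space
begin

lemma mp_action_if_mixing: "T \<in> mixing_actions M \<Gamma> \<Longrightarrow> mp_action M T"
  by (simp add: mixing_actions_def is_action_iff)

lemma mpt_convergent_if_cauchy_dense:
  assumes U: "\<And>n. measure_preserving_map M (U n)"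
    and cauchy: "\<And>k. cauchy_wrt (preimg_dist M (A k)) U"
  shows "\<exists>V. mpt_tendsto M U V"
proof -
  have "cauchy_wrt (preimg_dist M B) U" if "B \<in> sets M" for B
    by (rule cauchy_preimg_dist_if_cauchy_dense[OF U cauchy that])
  from mpt_tendsto_if_cauchy[OF U this] obtain V where "mpt_tendsto M U V" .
  then show ?thesis by (rule exI[where x = V])
qed

lemma convergent_on_K_if_cauchy:
  assumes X: "\<And>n. mp_action M (X n)" and cauchy: "cauchy_wrt dist_m X" and i: "i \<in> I" "g \<in> K i"
  shows "\<exists>U. mpt_tendsto M (\<lambda>n. X n g) U" "\<exists>U. mpt_tendsto M (\<lambda>n. X n (- g)) U"
proof -
  note inv = mp_action.invertible[OF X]
  have dominated: "cauchy_wrt (preimg_dist M (A k)) (\<lambda>n. X n h)"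
    if "\<And>p n. preimg_dist M (A k) (X p h) (X n h) \<le> 2 ^ k * dist_d M A (X p g) (X n g)" for h k
  proof (rule cauchy_wrt_dominated[OF cauchy])
    fix p n
    have "2 ^ k * dist_d M A (X p g) (X n g) \<le> 2 ^ k * (2 ^ i * dist_m (X p) (X n))"
      by (intro mult_left_mono dist_d_le_dist_m X i) simp
    from order_trans[OF that this]
    show "preimg_dist M (A k) (X p h) (X n h) \<le> (2 ^ k * 2 ^ i) * dist_m (X p) (X n)"
      by (simp only: mult.assoc)
  qed simp
  show "\<exists>U. mpt_tendsto M (\<lambda>n. X n g) U"
    by (intro mpt_convergent_if_cauchy_dense mp_action.preserving[OF X] dominated
        preimg_dist_le_dist_d inv)
  show "\<exists>U. mpt_tendsto M (\<lambda>n. X n (- g)) U"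
  proof (intro mpt_convergent_if_cauchy_dense mp_action.preserving[OF X] dominated)
    show "preimg_dist M (A k) (X p (- g)) (X n (- g)) \<le> 2 ^ k * dist_d M A (X p g) (X n g)" for p n k
      using img_dist_le_dist_d[OF inv inv, of p g k n g] by (simp add: preimg_dist_action[OF X X])
  qed
qed

lemma pointwise_limit_if_cauchy:
  assumes X: "\<And>n. mp_action M (X n)" and cauchy: "cauchy_wrt dist_m X"
  obtains V where "\<And>g. mpt_tendsto M (\<lambda>n. X n g) (V g)"
proof -
  let ?H = "{g. (\<exists>U. mpt_tendsto M (\<lambda>n. X n g) U) \<and> (\<exists>U. mpt_tendsto M (\<lambda>n. X n (- g)) U)}"
  have "g \<in> ?H" for g
  proof (rule generating_induct)
    show "is_subgroup ?H" by (rule is_subgroup_convergent[OF X])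
    show "(\<Union>i\<in>I. K i) \<subseteq> ?H" using convergent_on_K_if_cauchy[of X, OF X cauchy] by blast
  qed
  then have "\<forall>g. \<exists>U. mpt_tendsto M (\<lambda>n. X n g) U" by simp
  from choice[OF this] show ?thesis using that by blast
qed

context
  fixes X :: "nat \<Rightarrow> 'g \<Rightarrow> 'a \<Rightarrow> 'a" and V :: "'g \<Rightarrow> 'a \<Rightarrow> 'a"
  assumes X: "\<And>n. mp_action M (X n)" and cauchy: "cauchy_wrt dist_m X"
    and lim: "\<And>g. mpt_tendsto M (\<lambda>n. X n g) (V g)"
begin

lemma limit_mp_action: "mp_action M V"
  by (rule mp_action_limit[OF X lim])

lemma limit_dist_d_tendsto_0: "(\<lambda>n. dist_d M A (X n g) (V g)) \<longlonglongrightarrow> 0"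
  and limit_dist_a_tendsto_0: "(\<lambda>n. dist_a M A (X n g) (V g)) \<longlonglongrightarrow> 0"
proof -
  note inv = mp_action.invertible[OF X] mp_action.invertible[OF limit_mp_action]
  note lim_inv = mpt_tendsto_mpt_inv_action[OF X limit_mp_action lim]
  show "(\<lambda>n. dist_d M A (X n g) (V g)) \<longlonglongrightarrow> 0" by (rule dist_d_tendsto_0[OF inv lim lim_inv])
  show "(\<lambda>n. dist_a M A (X n g) (V g)) \<longlonglongrightarrow> 0" by (rule dist_a_tendsto_0[OF inv lim lim_inv])
qed

lemma limit_sup_d_tendsto_0: "(\<lambda>n. sup_d i (X n) V) \<longlonglongrightarrow> 0"
proof (cases "i \<in> I")
  case True
  have "cauchy_wrt (sup_d i) X"
    using sup_d_le_dist_m[OF X X] by (intro cauchy_wrt_dominated[OF cauchy, of "2 ^ i"]) simp_all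
  then have "cauchy_wrt (\<lambda>T S. SUP g\<in>K i. dist_d M A (T g) (S g)) X"
    using True by (simp add: sup_d_def[abs_def])
  then have "(\<lambda>n. SUP g\<in>K i. dist_d M A (X n g) (V g)) \<longlonglongrightarrow> 0"
    using X limit_mp_action limit_dist_d_tendsto_0
    by (intro SUP_tendsto_0_if_cauchy_wrt_SUP[OF bounded_pseudometric_dist_d_action
          K_nonempty[OF True]]) simp_all
  then show ?thesis using True by (simp add: sup_d_def)
qed (simp add: sup_d_def)

lemma limit_sup_a_tendsto_0: "(\<lambda>n. sup_a (X n) V) \<longlonglongrightarrow> 0"
proof -
  have "cauchy_wrt sup_a X"
    using sup_a_le_dist_m[OF X X] by (intro cauchy_wrt_dominated[OF cauchy, of 1]) simp_all
  then show ?thesis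
    unfolding sup_a_def[abs_def]
    using X limit_mp_action limit_dist_a_tendsto_0
    by (intro SUP_tendsto_0_if_cauchy_wrt_SUP[OF bounded_pseudometric_dist_a_action
          \<Gamma>_nonempty]) simp_all
qed

lemma limit_dist_m_tendsto_0: "(\<lambda>n. dist_m (X n) V) \<longlonglongrightarrow> 0"
proof -
  have "(\<lambda>n. dyadic_sum (\<lambda>i. sup_d i (X n) V)) \<longlonglongrightarrow> 0"
    by (rule dyadic_sum_tendsto_0[OF sup_d_range[OF X limit_mp_action] limit_sup_d_tendsto_0])
  then show ?thesis unfolding dist_m_eq by (rule tendsto_add_zero[OF _ limit_sup_a_tendsto_0])
qed

lemma limit_uniform_limit_corr:
  assumes i: "i \<in> I" and B: "B \<in> sets M" and C: "C \<in> sets M"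
  shows "uniform_limit (K i) (\<lambda>n g. corr (X n g) B C) (\<lambda>g. corr (V g) B C) sequentially"
proof (rule uniform_limitI)
  fix e :: real assume "0 < e"
  then obtain k where near: "sdist M B (A k) < e / 4" using dense_A[OF B, of "e / 4"] by auto
  have "\<forall>\<^sub>F n in sequentially. sup_d i (X n) V < e / 2 / 2 ^ k"
    using \<open>0 < e\<close> by (intro order_tendstoD(2)[OF limit_sup_d_tendsto_0]) simp
  then show "\<forall>\<^sub>F n in sequentially. \<forall>g\<in>K i. dist (corr (X n g) B C) (corr (V g) B C) < e"
  proof eventually_elim
    case (elim n)
    show ?case
    proof
      fix g assume "g \<in> K i"
      then have "dist_d M A (X n g) (V g) < e / 2 / 2 ^ k"
        using dist_d_le_sup_d[OF X limit_mp_action i] elim le_less_trans by blast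
      then have "2 ^ k * dist_d M A (X n g) (V g) < e / 2" by (simp add: field_simps)
      then show "dist (corr (X n g) B C) (corr (V g) B C) < e"
        using abs_corr_diff_le_dist_d[OF mp_action.invertible[OF X]
            mp_action.invertible[OF limit_mp_action] B C, of n g g k] near
        unfolding dist_real_def by linarith
    qed
  qed
qed

end

lemma limit_is_action:
  assumes X: "\<And>n. is_action M (X n)" and cauchy: "cauchy_wrt dist_m X"
    and lim: "\<And>g. mpt_tendsto M (\<lambda>n. X n g) (V g)"
  shows "is_action M V"
proof -
  have X_mp: "mp_action M (X n)" for n using X by (simp add: is_action_iff)
  obtain i where i: "i \<in> I" using I_nonempty by blast
  show ?thesis
  proof (rule is_action_if_continuous_on_interior[OF group _ _ interior_K[OF i]])
    show "mp_action M V" by (rule limit_mp_action[OF X_mp cauchy lim])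
    fix B C assume BC: "B \<in> sets M" "C \<in> sets M"
    have "continuous_on (K i) (\<lambda>g. corr (X n g) B C)" for n
      using X[of n] BC by (auto simp: is_action_iff intro: continuous_on_subset)
    then show "continuous_on (K i) (\<lambda>g. corr (V g) B C)"
      by (intro uniform_limit_theorem[OF _ limit_uniform_limit_corr[OF X_mp cauchy lim i BC]])
        simp_all
  qed
qed

lemma limit_gamma_mixing:
  assumes X: "\<And>n. X n \<in> mixing_actions M \<Gamma>" and cauchy: "cauchy_wrt dist_m X"
    and lim: "\<And>g. mpt_tendsto M (\<lambda>n. X n g) (V g)"
  shows "gamma_mixing M \<Gamma> V"
  unfolding gamma_mixing_def
proof (intro ballI allI impI)
  note X_mp = mp_action_if_mixing[OF X]
  note V_mp = limit_mp_action[OF X_mp cauchy lim]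
  fix B C and e :: real assume B: "B \<in> sets M" and C: "C \<in> sets M" and e_pos: "0 < e"
  obtain k where near_B: "sdist M B (A k) < e / 8" using dense_A[OF B, of "e / 8"] e_pos by auto
  obtain l where near_C: "sdist M C (A l) < e / 8" using dense_A[OF C, of "e / 8"] e_pos by auto
  have "\<forall>\<^sub>F n in sequentially. sup_a (X n) V < e / 4 / 2 ^ (k + l)"
    using e_pos by (intro order_tendstoD(2)[OF limit_sup_a_tendsto_0[OF X_mp cauchy lim]]) simp
  then obtain n where close: "sup_a (X n) V < e / 4 / 2 ^ (k + l)"
    by (auto dest: eventually_happens)
  have "\<forall>e>0. \<exists>Q. compact Q \<and> (\<forall>g\<in>\<Gamma> - Q. \<bar>corr (X n g) B C - measure M B * measure M C\<bar> < e)"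
    using X[of n] B C by (simp add: mixing_actions_def gamma_mixing_def)
  from this[rule_format, of "e / 4"] e_pos obtain Q where "compact Q" and mixing_Xn:
    "\<And>g. g \<in> \<Gamma> - Q \<Longrightarrow> \<bar>corr (X n g) B C - measure M B * measure M C\<bar> < e / 4"
    by auto
  have "\<bar>corr (V g) B C - measure M B * measure M C\<bar> < e" if g: "g \<in> \<Gamma> - Q" for g
  proof -
    have "dist_a M A (X n g) (V g) < e / 4 / 2 ^ (k + l)"
      using dist_a_le_sup_a[OF X_mp V_mp, of g n] g close by simp
    then have "2 ^ (k + l) * dist_a M A (X n g) (V g) < e / 4" by (simp add: field_simps)
    then show ?thesis
      using abs_corr_diff_le_dist_a[OF mp_action.invertible[OF X_mp]
          mp_action.invertible[OF V_mp] B C, of n g g k l] mixing_Xn[OF g] near_B near_C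
      by linarith
  qed
  with \<open>compact Q\<close>
  show "\<exists>Q. compact Q \<and> (\<forall>g\<in>\<Gamma> - Q. \<bar>corr (V g) B C - measure M B * measure M C\<bar> < e)"
    by blast
qed

lemma dist_m_complete:
  assumes X: "\<And>n. X n \<in> mixing_actions M \<Gamma>" and cauchy: "cauchy_wrt dist_m X"
  shows "\<exists>V\<in>mixing_actions M \<Gamma>. (\<lambda>n. dist_m (X n) V) \<longlonglongrightarrow> 0"
proof -
  note X_mp = mp_action_if_mixing[OF X]
  obtain V where lim: "\<And>g. mpt_tendsto M (\<lambda>n. X n g) (V g)"
    using pointwise_limit_if_cauchy[of X, OF X_mp cauchy] by blast
  have "is_action M (X n)" for n using X by (simp add: mixing_actions_def)
  then have "is_action M V" by (rule limit_is_action[OF _ cauchy lim])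
  moreover have "gamma_mixing M \<Gamma> V" by (rule limit_gamma_mixing[OF X cauchy lim])
  ultimately have "V \<in> mixing_actions M \<Gamma>" by (simp add: mixing_actions_def)
  then show ?thesis using limit_dist_m_tendsto_0[OF X_mp cauchy lim] by blast
qed

end

subsection \<open>Separability\<close>

lemma compact_finite_cell_cover:
  assumes P: "compact P" and cell: "\<And>x. x \<in> P \<Longrightarrow> \<exists>U k. open U \<and> x \<in> U \<and> cell U k"
  obtains c where "finite c" "P \<subseteq> \<Union>(fst ` c)" "\<And>U k. (U, k) \<in> c \<Longrightarrow> cell U k"
proof -
  obtain U k where Uk: "\<And>x. x \<in> P \<Longrightarrow> open (U x) \<and> x \<in> U x \<and> cell (U x) (k x)"
    using cell by metis
  then have "P \<subseteq> (\<Union>x\<in>P. U x)" by blast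
  from compactE_image[OF P _ this] Uk obtain D where
    D: "D \<subseteq> P" "finite D" "P \<subseteq> (\<Union>x\<in>D. U x)" by metis
  show ?thesis
  proof
    show "finite ((\<lambda>x. (U x, k x)) ` D)" using D(2) by simp
    show "P \<subseteq> \<Union>(fst ` (\<lambda>x. (U x, k x)) ` D)" using D(3) by (simp add: image_image)
    show "cell V l" if "(V, l) \<in> (\<lambda>x. (U x, k x)) ` D" for V l using that D(1) Uk by blast
  qed
qed

lemma (in prob_space) continuous_on_sdist_mpt_img:
  fixes T :: "'g::{group_add,topological_space} \<Rightarrow> 'a \<Rightarrow> 'a"
  assumes T: "is_action M T" and B: "B \<in> sets M" and C: "C \<in> sets M"
  shows "continuous_on UNIV (\<lambda>g. sdist M (mpt_img M (T g) B) C)"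
proof -
  have inv: "invertible_mpt M (T g)" for g using T by (simp add: is_action_def)
  have "continuous_on UNIV (\<lambda>g. corr (T g) B C)" using T B C by (simp add: is_action_def)
  then have "continuous_on UNIV (\<lambda>g. measure M B + measure M C - 2 * corr (T g) B C)"
    by (intro continuous_intros)
  then show ?thesis using B C inv by (simp add: sdist_eq measure_mpt_img)
qed

context mixing_space
begin

text \<open>A code is a finite set of cells \<open>(U, ks)\<close>: on the open set \<open>U\<close> the sets \<open>T\<^sup>g A\<^sub>i\<close> stay close
  to \<open>A\<^bsub>ks ! i\<^esub>\<close>. Off the cells, mixing makes the correlations along \<open>\<Gamma>\<close> almost independent of \<open>T\<close>,
  so actions with a common code are close.\<close>

definition coded :: "nat \<Rightarrow> ('g set \<times> nat list) set \<Rightarrow> ('g \<Rightarrow> 'a \<Rightarrow> 'a) \<Rightarrow> bool" where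
  "coded N c T \<longleftrightarrow>
     (\<forall>(U, ks)\<in>c. \<forall>g\<in>U. \<forall>i<N. sdist M (mpt_img M (T g) (A i)) (A (ks ! i)) < (1/2) ^ N) \<and>
     (\<forall>i\<in>I. i < N \<longrightarrow> K i \<union> uminus ` K i \<subseteq> \<Union>(fst ` c)) \<and>
     (\<forall>g\<in>\<Gamma> - \<Union>(fst ` c). \<forall>i<N. \<forall>j<N.
        \<bar>corr (T g) (A i) (A j) - measure M (A i) * measure M (A j)\<bar> < (1/2) ^ N)"

lemma cell_exists:
  assumes \<B>: "topological_basis \<B>" and T: "is_action M T" and e_pos: "0 < e"
  obtains U ks where "U \<in> \<B>" "g \<in> U"
    "\<And>h i. h \<in> U \<Longrightarrow> i < N \<Longrightarrow> sdist M (mpt_img M (T h) (A i)) (A (ks ! i)) < e"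
proof -
  have "\<exists>k. sdist M (mpt_img M (T g) (A i)) (A k) < e" for i
    using T e_pos by (intro dense_A mpt_img_sets sets_A) (simp_all add: is_action_def)
  then obtain k where near: "\<And>i. sdist M (mpt_img M (T g) (A i)) (A (k i)) < e" by metis
  define W where "W = (\<Inter>i<N. {h. sdist M (mpt_img M (T h) (A i)) (A (k i)) < e})"
  have "open W"
    unfolding W_def
    by (intro open_INT ballI open_Collect_less continuous_on_sdist_mpt_img[OF T]
        continuous_on_const sets_A) simp
  moreover have "g \<in> W" using near by (simp add: W_def)
  ultimately obtain U where U: "U \<in> \<B>" "g \<in> U" "U \<subseteq> W" by (rule topological_basisE[OF \<B>])
  show ?thesis
  proof (rule that[OF U(1,2)])
    show "sdist M (mpt_img M (T h) (A i)) (A (map k [0..<N] ! i)) < e" if "h \<in> U" "i < N" for h i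
      using that U(3) by (auto simp: W_def)
  qed
qed

lemma finitely_many_correlations_mix:
  assumes T: "gamma_mixing M \<Gamma> T" and e_pos: "0 < e"
  obtains Q where "compact Q"
    "\<And>g i j. g \<in> \<Gamma> - Q \<Longrightarrow> i < N \<Longrightarrow> j < N \<Longrightarrow>
      \<bar>corr (T g) (A i) (A j) - measure M (A i) * measure M (A j)\<bar> < e"
proof -
  have "\<exists>Q. compact Q \<and>
      (\<forall>g\<in>\<Gamma> - Q. \<bar>corr (T g) (A i) (A j) - measure M (A i) * measure M (A j)\<bar> < e)" for i j
    using T e_pos by (simp add: gamma_mixing_def)
  then obtain Q where Q: "\<And>i j. compact (Q i j)"
    "\<And>i j g. g \<in> \<Gamma> - Q i j \<Longrightarrow>
      \<bar>corr (T g) (A i) (A j) - measure M (A i) * measure M (A j)\<bar> < e"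
    by metis
  show ?thesis
  proof
    show "compact (\<Union>i<N. \<Union>j<N. Q i j)" using Q(1) by (intro compact_UN) auto
    show "\<bar>corr (T g) (A i) (A j) - measure M (A i) * measure M (A j)\<bar> < e"
      if "g \<in> \<Gamma> - (\<Union>i<N. \<Union>j<N. Q i j)" "i < N" "j < N" for g i j
      using that by (intro Q(2)) blast
  qed
qed

lemma coded_exists:
  assumes \<B>: "topological_basis \<B>" and T: "T \<in> mixing_actions M \<Gamma>"
  obtains c where "c \<in> Fpow (\<B> \<times> UNIV)" "coded N c T"
proof -
  let ?\<delta> = "(1/2) ^ N :: real"
  have \<delta>: "0 < ?\<delta>" by simp
  have act: "is_action M T" and mixing: "gamma_mixing M \<Gamma> T" using T
    by (simp_all add: mixing_actions_def)
  obtain Q where Q: "compact Q" "\<And>g i j. g \<in> \<Gamma> - Q \<Longrightarrow> i < N \<Longrightarrow> j < N \<Longrightarrow>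
      \<bar>corr (T g) (A i) (A j) - measure M (A i) * measure M (A j)\<bar> < ?\<delta>"
    using finitely_many_correlations_mix[OF mixing \<delta>] by metis
  define P where "P = Q \<union> (\<Union>i\<in>I \<inter> {..<N}. K i \<union> uminus ` K i)"
  have P: "compact P"
    unfolding P_def using Q(1) compact_K
    by (intro compact_Un compact_UN compact_continuous_image
        continuous_on_group_minus[OF group continuous_on_id]) auto
  define cell where "cell U ks \<longleftrightarrow> U \<in> \<B> \<and>
    (\<forall>g\<in>U. \<forall>i<N. sdist M (mpt_img M (T g) (A i)) (A (ks ! i)) < ?\<delta>)" for U ks
  have "\<exists>U ks. open U \<and> g \<in> U \<and> cell U ks" for g
  proof (rule cell_exists[OF \<B> act \<delta>])
    fix U ks assume U: "U \<in> \<B>" "g \<in> U"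
      and "\<And>h i. h \<in> U \<Longrightarrow> i < N \<Longrightarrow> sdist M (mpt_img M (T h) (A i)) (A (ks ! i)) < ?\<delta>"
    then have "cell U ks" by (simp add: cell_def)
    with U show ?thesis using topological_basis_open[OF \<B>] by blast
  qed
  then obtain c where c: "finite c" "P \<subseteq> \<Union>(fst ` c)" "\<And>U ks. (U, ks) \<in> c \<Longrightarrow> cell U ks"
    by (rule compact_finite_cell_cover[OF P, of cell]) blast
  show ?thesis
  proof
    have "c \<subseteq> \<B> \<times> UNIV" using c(3) by (auto simp: cell_def)
    then show "c \<in> Fpow (\<B> \<times> UNIV)" using c(1) by (simp add: Fpow_def)
    have "\<forall>(U, ks)\<in>c. \<forall>g\<in>U. \<forall>i<N. sdist M (mpt_img M (T g) (A i)) (A (ks ! i)) < ?\<delta>"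
      using c(3) by (auto simp: cell_def)
    moreover have "K i \<union> uminus ` K i \<subseteq> \<Union>(fst ` c)" if "i \<in> I" "i < N" for i
    proof -
      have "K i \<union> uminus ` K i \<subseteq> P" using that unfolding P_def by blast
      then show ?thesis using c(2) by (rule order_trans)
    qed
    moreover have "\<bar>corr (T g) (A i) (A j) - measure M (A i) * measure M (A j)\<bar> < ?\<delta>"
      if "g \<in> \<Gamma> - \<Union>(fst ` c)" "i < N" "j < N" for g i j
      using that c(2) by (intro Q(2)) (auto simp: P_def)
    ultimately show "coded N c T" by (simp add: coded_def)
  qed
qed

context
  fixes N :: nat and c :: "('g set \<times> nat list) set" and T S :: "'g \<Rightarrow> 'a \<Rightarrow> 'a"
  assumes T: "mp_action M T" and S: "mp_action M S"
    and coded_T: "coded N c T" and coded_S: "coded N c S"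
begin

lemma coded_img_dist_le:
  assumes g: "g \<in> \<Union>(fst ` c)" and i: "i < N"
  shows "img_dist M (A i) (T g) (S g) \<le> 2 * (1/2) ^ N"
proof -
  obtain U ks where cell: "(U, ks) \<in> c" "g \<in> U" using g by auto
  have near: "sdist M (mpt_img M (R g) (A i)) (A (ks ! i)) < (1/2) ^ N" if "coded N c R" for R
    using bspec[OF conjunct1[OF that[unfolded coded_def]] cell(1)] cell(2) i by simp
  have "img_dist M (A i) (T g) (S g)
      \<le> sdist M (mpt_img M (T g) (A i)) (A (ks ! i)) + sdist M (A (ks ! i)) (mpt_img M (S g) (A i))"
    using T S by (intro sdist_triangle) (auto intro: mp_action.invertible)
  then show ?thesis
    using near[OF coded_T] near[OF coded_S] sdist_commute[of M "A (ks ! i)"] by simp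
qed

lemma coded_dist_d_le:
  assumes g: "g \<in> \<Union>(fst ` c)" "- g \<in> \<Union>(fst ` c)"
  shows "dist_d M A (T g) (S g) \<le> 12 * (1/2) ^ N"
proof -
  have "dist_d M A (T g) (S g) \<le> 2 * (4 * (1/2) ^ N) + 2 * 2 * (1/2) ^ N"
    unfolding dist_d_eq
  proof (rule dyadic_sum_le_if_initial_le)
    show "dist_d_term i (T g) (S g) \<in> {0..2}" for i
      using T S by (intro bounded_pseudometric.range[OF bounded_pseudometric_dist_d_term])
        (simp_all add: mp_action.invertible)
    show "dist_d_term i (T g) (S g) \<le> 4 * (1/2) ^ N" if "i < N" for i
      using coded_img_dist_le[OF g(1) that] coded_img_dist_le[OF g(2) that]
      by (simp add: dist_d_term_def preimg_dist_action[OF T S])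
  qed simp
  then show ?thesis by simp
qed

lemma coded_dist_a_le:
  assumes g: "g \<in> \<Gamma>"
  shows "dist_a M A (T g) (S g) \<le> 16 * (1/2) ^ N"
proof -
  have initial: "dist_a_term i j (T g) (S g) \<le> 2 * (1/2) ^ N" if ij: "i < N" "j < N" for i j
  proof (cases "g \<in> \<Union>(fst ` c)")
    case True
    then show ?thesis
      using dist_a_term_le_img_dist[OF mp_action.invertible[OF T] mp_action.invertible[OF S]]
        coded_img_dist_le[OF _ ij(1)] order_trans by blast
  next
    case False
    have "\<bar>corr (R g) (A i) (A j) - measure M (A i) * measure M (A j)\<bar> < (1/2) ^ N"
      if "coded N c R" for R
      using that False g ij unfolding coded_def by blast
    from this[OF coded_T] this[OF coded_S] show ?thesis unfolding dist_a_term_def by linarith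
  qed
  have "dist_a M A (T g) (S g) \<le> 2 * (6 * (1/2) ^ N) + 2 * 2 * (1/2) ^ N"
    unfolding dist_a_eq
  proof (rule dyadic_sum_le_if_initial_le)
    show "dyadic_sum (\<lambda>j. dist_a_term i j (T g) (S g)) \<in> {0..2}" for i
      using dyadic_sum_range[OF dist_a_term_range] by simp
    fix i assume i: "i < N"
    have "dyadic_sum (\<lambda>j. dist_a_term i j (T g) (S g)) \<le> 2 * (2 * (1/2) ^ N) + 2 * 1 * (1/2) ^ N"
      by (rule dyadic_sum_le_if_initial_le[OF dist_a_term_range initial[OF i]]) simp_all
    then show "dyadic_sum (\<lambda>j. dist_a_term i j (T g) (S g)) \<le> 6 * (1/2) ^ N" by simp
  qed simp
  then show ?thesis by simp
qed

lemma coded_dist_m_le: "dist_m T S \<le> 48 * (1/2) ^ N"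
proof -
  have "sup_d i T S \<le> 12 * (1/2) ^ N" if "i < N" for i
  proof (cases "i \<in> I")
    case True
    then have "K i \<union> uminus ` K i \<subseteq> \<Union>(fst ` c)" using coded_T \<open>i < N\<close> by (simp add: coded_def)
    then have "dist_d M A (T g) (S g) \<le> 12 * (1/2) ^ N" if "g \<in> K i" for g
      using that by (intro coded_dist_d_le) blast+
    then show ?thesis using True K_nonempty by (simp add: sup_d_def cSUP_least)
  qed (simp add: sup_d_def)
  then have "dyadic_sum (\<lambda>i. sup_d i T S) \<le> 2 * (12 * (1/2) ^ N) + 2 * 4 * (1/2) ^ N"
    by (intro dyadic_sum_le_if_initial_le sup_d_range T S) simp_all
  moreover have "sup_a T S \<le> 16 * (1/2) ^ N"
    unfolding sup_a_def by (intro cSUP_least \<Gamma>_nonempty coded_dist_a_le)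
  ultimately show ?thesis by (simp add: dist_m_eq)
qed

end

lemma second_countable:
  obtains \<B> :: "'g set set" where "countable \<B>" "topological_basis \<B>"
proof -
  define L where "L n = (if n \<in> I then K n else {})" for n
  have "(\<Union>n. L n) = (\<Union>i\<in>I. K i)" by (auto simp: L_def)
  then have "generated_subgroup (\<Union>n. L n) = UNIV" by (simp add: generating)
  moreover have "compact (L n)" for n by (simp add: L_def compact_K)
  ultimately obtain C :: "nat \<Rightarrow> 'g set" where "\<And>n. compact (C n)" "(\<Union>n. C n) = UNIV"
    using sigma_compact_if_generated[OF group, of L] by blast
  then show ?thesis by (rule second_countable_if_sigma_compact[OF group _ _ that])
qed

lemma dist_m_separable:
  "\<exists>D\<subseteq>mixing_actions M \<Gamma>. countable D \<and> (\<forall>T\<in>mixing_actions M \<Gamma>. \<forall>e>0. \<exists>S\<in>D. dist_m T S < e)"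
proof (rule separable_if_countable_small_covers)
  fix e :: real assume "0 < e"
  then obtain N where small: "(1/2) ^ N < e / 48" using real_arch_pow_inv[of "e / 48" "1/2"] by auto
  obtain \<B> :: "'g set set" where \<B>: "countable \<B>" "topological_basis \<B>" by (rule second_countable)
  define \<U> where "\<U> = (\<lambda>c. Collect (coded N c)) ` Fpow (\<B> \<times> UNIV)"
  have "countable \<U>" unfolding \<U>_def using \<B>(1)
    by (intro countable_image countable_Fpow countable_SIGMA) auto
  moreover have "mixing_actions M \<Gamma> \<subseteq> \<Union>\<U>"
  proof
    fix T assume "T \<in> mixing_actions M \<Gamma>"
    then obtain c where "c \<in> Fpow (\<B> \<times> UNIV)" "coded N c T" by (rule coded_exists[OF \<B>(2)])
    then show "T \<in> \<Union>\<U>" by (auto simp: \<U>_def)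
  qed
  moreover have "dist_m T S < e"
    if U: "U \<in> \<U>" and T: "T \<in> mixing_actions M \<Gamma> \<inter> U" and S: "S \<in> mixing_actions M \<Gamma> \<inter> U" for U T S
  proof -
    obtain c where "coded N c T" "coded N c S" using U T S by (auto simp: \<U>_def)
    then have "dist_m T S \<le> 48 * (1/2) ^ N"
      using T S by (intro coded_dist_m_le[of T S N c]) (simp_all add: mp_action_if_mixing)
    then show ?thesis using small by simp
  qed
  ultimately show "\<exists>\<U>. countable \<U> \<and> mixing_actions M \<Gamma> \<subseteq> \<Union>\<U> \<and>
      (\<forall>U\<in>\<U>. \<forall>T\<in>mixing_actions M \<Gamma> \<inter> U. \<forall>S\<in>mixing_actions M \<Gamma> \<inter> U. dist_m T S < e)"
    by blast
qed

end

lemma mixing_space_exists: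
  fixes K :: "nat \<Rightarrow> 'g::{group_add,t2_space,first_countable_topology} set"
  assumes M: "nonatomic_lebesgue_space M" and A: "generating_dense_family M A"
    and group: "lc_topological_group TYPE('g)"
    and K: "\<forall>i\<in>I. compact (K i) \<and> interior (K i) \<noteq> {}"
    and S: "\<exists>S. S \<subseteq> (\<Union>i\<in>I. K i) \<and> generated_subgroup S = UNIV"
    and \<Gamma>: "unbounded_set \<Gamma>"
  obtains \<phi> \<psi> where "mixing_space M \<phi> \<psi> A I K \<Gamma>"
proof -
  obtain \<phi> \<psi> where "lebesgue_space M \<phi> \<psi>"
    using lebesgue_space_if_nonatomic_lebesgue_space[OF M] by blast
  then interpret lebesgue_space M \<phi> \<psi> .
  have "mixing_space M \<phi> \<psi> A I K \<Gamma>"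
  proof
    show "A i \<in> sets M" for i using A by (simp add: generating_dense_family_def)
    show "\<exists>i. sdist M B (A i) < e" if "B \<in> sets M" "0 < e" for B e
      using A that by (simp add: generating_dense_family_def sdist_def symdiff_def)
    show "topological_group TYPE('g)" using group
      by (simp add: lc_topological_group_def topological_group_def)
    show "compact (K i)" "interior (K i) \<noteq> {}" if "i \<in> I" for i using K that by auto
    show "generated_subgroup (\<Union>i\<in>I. K i) = UNIV"
      using S generated_subgroup_mono by (metis top.extremum_uniqueI)
    show "unbounded_set \<Gamma>" by (rule \<Gamma>)
  qed
  then show ?thesis by (rule that)
qed

theorem theorem1:
  fixes M :: "'a measure" and A :: "nat \<Rightarrow> 'a set"
    and I :: "nat set" and K :: "nat \<Rightarrow> 'g::{group_add,t2_space,first_countable_topology} set"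
    and \<Gamma> :: "'g set"
  assumes "nonatomic_lebesgue_space M"
    and "generating_dense_family M A"
    and "lc_topological_group TYPE('g)"
    and "\<forall>i\<in>I. compact (K i) \<and> interior (K i) \<noteq> {}"
    and "\<exists>S. S \<subseteq> (\<Union>i\<in>I. K i) \<and> generated_subgroup S = UNIV"
    and "unbounded_set \<Gamma>"
  shows
    "(\<forall>T\<in>mixing_actions M \<Gamma>. \<forall>S\<in>mixing_actions M \<Gamma>.
        metric_m M A I K \<Gamma> T S = metric_m M A I K \<Gamma> S T \<and>
        (metric_m M A I K \<Gamma> T S = 0 \<longleftrightarrow> action_equiv M T S) \<and>
        (\<forall>R\<in>mixing_actions M \<Gamma>.
           metric_m M A I K \<Gamma> T R \<le> metric_m M A I K \<Gamma> T S + metric_m M A I K \<Gamma> S R))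
   \<and> (\<forall>X :: nat \<Rightarrow> 'g \<Rightarrow> 'a \<Rightarrow> 'a. (\<forall>n. X n \<in> mixing_actions M \<Gamma>) \<longrightarrow>
        (\<forall>\<epsilon>>0. \<exists>N. \<forall>m\<ge>N. \<forall>n\<ge>N. metric_m M A I K \<Gamma> (X m) (X n) < \<epsilon>) \<longrightarrow>
        (\<exists>T\<in>mixing_actions M \<Gamma>. (\<lambda>n. metric_m M A I K \<Gamma> (X n) T) \<longlonglongrightarrow> 0))
   \<and> (\<exists>D \<subseteq> mixing_actions M \<Gamma>. countable D \<and>
        (\<forall>T\<in>mixing_actions M \<Gamma>. \<forall>\<epsilon>>0. \<exists>S\<in>D. metric_m M A I K \<Gamma> T S < \<epsilon>))"
proof -
  obtain \<phi> \<psi> where "mixing_space M \<phi> \<psi> A I K \<Gamma>"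
    by (rule mixing_space_exists[OF assms])
  then interpret mixing_space M \<phi> \<psi> A I K \<Gamma> .
  interpret dist_m: bounded_pseudometric "Collect (mp_action M)" 12 dist_m
    by (rule bounded_pseudometric_dist_m)
  show ?thesis
  proof (intro conjI ballI allI impI)
    fix T S assume TS: "T \<in> mixing_actions M \<Gamma>" "S \<in> mixing_actions M \<Gamma>"
    note mp = mp_action_if_mixing[OF TS(1)] mp_action_if_mixing[OF TS(2)]
    show "dist_m T S = dist_m S T" using mp by (intro dist_m.commute) simp_all
    show "dist_m T S = 0 \<longleftrightarrow> action_equiv M T S" by (rule dist_m_eq_0_iff[OF mp])
    show "dist_m T R \<le> dist_m T S + dist_m S R" if "R \<in> mixing_actions M \<Gamma>" for R
      using mp mp_action_if_mixing[OF that] by (intro dist_m.triangle) simp_all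
  next
    fix X :: "nat \<Rightarrow> 'g \<Rightarrow> 'a \<Rightarrow> 'a"
    assume "\<forall>n. X n \<in> mixing_actions M \<Gamma>" "\<forall>\<epsilon>>0. \<exists>N. \<forall>p\<ge>N. \<forall>n\<ge>N. dist_m (X p) (X n) < \<epsilon>"
    then show "\<exists>T\<in>mixing_actions M \<Gamma>. (\<lambda>n. dist_m (X n) T) \<longlonglongrightarrow> 0"
      by (intro dist_m_complete) (simp_all add: cauchy_wrt_def)
  qed (rule dist_m_separable)
qed

end
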